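(* For $n\ge1$, $$|\mathrm{DSASM}^\ast(2n)|=|\mathrm{DSASM}^\dagger(2n)|=|\mathrm{OSASM}^\ast(2n)|=|\mathrm{OSASM}^\dagger(2n)|=0,$$ $$|\mathrm{DSASM}^\ast(2n+1)|=|\mathrm{DSASM}^\dagger(2n+1)|=|\mathrm{DSASM}^{\ast\dagger}(2n+1)|=|\mathrm{OSASM}(2n)|,$$ $$|\mathrm{DSASM}^{\ast\dagger}(2n)|=2\,|\mathrm{OSASM}(2n-1)|,$$ and $$|\mathrm{OSASM}^{\ast\dagger}(2n)|=|\mathrm{OSASM}^\ast(2n+1)|=|\mathrm{OSASM}^\dagger(2n+1)|=|\mathrm{OSASM}^{\ast\dagger}(2n+1)|=|\mathrm{ASM}(n)|.$$
   Context: An alternating sign matrix (ASM) is a square matrix with entries in $\{0,1,-1\}$ such that along each row and each column the nonzero entries alternate in sign and have sum $1$. $\mathrm{ASM}(n)$ is the set of $n\times n$ ASMs, and $\mathrm{DSASM}(n)$ is the set of $n\times n$ ASMs equal to their transpose. An off-diagonally symmetric ASM (OSASM) is, for even order, a DSASM in which every diagonal entry is $0$, and, for odd order, a DSASM in which exactly one diagonal entry is nonzero; $\mathrm{OSASM}(n)$ is the set of $n\times n$ OSASMs. Graph $\mathcal T_n$ (rows numbered downwards, columns rightwards): vertices are top vertices $(0,j)$, $1\le j\le n$; left boundary vertices $(i,i)$, $1\le i\le n$; bulk vertices $(i,j)$, $1\le i<j\le n$; right boundary vertices $(i,n+1)$, $1\le i\le n$. Edges are the vertical edges between $(i-1,j)$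 and $(i,j)$ and the horizontal edges between $(i,j)$ and $(i,j+1)$, for $1\le i\le j\le n$. $\mathrm{6V}(n)$ is the set of orientations of the edges of $\mathcal T_n$ such that each bulk vertex has two incoming and two outgoing edges, each edge at a top vertex is directed upward, and each edge at a right boundary vertex is directed leftward. There is a bijection between $\mathrm{DSASM}(n)$ and $\mathrm{6V}(n)$ in which the DSASM $A$ corresponding to $C\in\mathrm{6V}(n)$ is given, for $1\le i\le j\le n$, by: for $i<j$, $A_{ij}=A_{ji}=1$ if at $(i,j)$ both vertical edges are directed out of the vertex and both horizontal edges into it, $A_{ij}=A_{ji}=-1$ if both vertical edges are directed into the vertex and both horizontal edges out of it, and $A_{ij}=A_{ji}=0$ otherwise; $A_{ii}=1$ if at $(i,i)$ the upper edge points up and the right edge points left, $A_{ii}=-1$ if the upper edge points down and the right edge points right, and $A_{ii}=0$ otherwise. The involution $\ast$ on $\mathrm{DSASM}(n)$: for $n=1$ it is the identity. For $n\ge2$, if $A$ corresponds to $C$, then $A^\ast$ corresponds to $C^\ast$, obtained from $C$ by, for every $k=2,\ldots,n$, interchanging the orientations of the two edges which connect the superdiagonal vertex $(k-1,k)$ to $(k-1,k-1)$ and to $(k,k)$ (where an orientation is regarded as being into or out of $(k-1,k)$), leaving all other edges unchanged. The involution $\dagger$ on $\mathrm{DSASM}(n)$: if $A^\ast=A$ then $A^\dagger=A$. Otherwise, let $(k-1,k)$ be the first superdiagonal vertex (smallest $k$) at which, in the configuration $C$ corresponding to $A$, exactly one of the two edges connecting $(k-1,k)$ to $(k-1,k-1)$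 and $(k,k)$ is directed into $(k-1,k)$; then $A^\dagger$ corresponds to the configuration obtained from $C$ by interchanging the orientations (into/out of $(k-1,k)$) of those two edges for this $k$ only, leaving all other edges unchanged. The involutions $\ast$ and $\dagger$ commute and $\ast\dagger$ denotes their composition. For $\nu\in\{\ast,\dagger,\ast\dagger\}$, $\mathrm{DSASM}^\nu(n)=\{A\in\mathrm{DSASM}(n)\mid A^\nu=A\}$ and $\mathrm{OSASM}^\nu(n)=\{A\in\mathrm{OSASM}(n)\mid A^\nu=A\}$. *)

theory Defs
  imports "Jordan_Normal_Form.Matrix"
begin

definition alternating_line :: "int vec \<Rightarrow> bool" where
  "alternating_line v \<longleftrightarrow>
     successively (\<lambda>x y. sgn x = - sgn y) (filter (\<lambda>x. x \<noteq> 0) (list_of_vec v)) \<and>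
     sum_list (list_of_vec v) = 1"

definition ASM :: "nat \<Rightarrow> int mat set" where
  "ASM n = {A \<in> carrier_mat n n.
     (\<forall>i<n. \<forall>j<n. A $$ (i, j) \<in> {0, 1, -1}) \<and>
     (\<forall>i<n. alternating_line (row A i)) \<and>
     (\<forall>j<n. alternating_line (col A j))}"

definition DSASM :: "nat \<Rightarrow> int mat set" where
  "DSASM n = {A \<in> ASM n. transpose_mat A = A}"

definition OSASM :: "nat \<Rightarrow> int mat set" where
  "OSASM n = {A \<in> DSASM n.
     if even n then \<forall>i<n. A $$ (i, i) = 0
     else card {i. i < n \<and> A $$ (i, i) \<noteq> 0} = 1}"

text \<open>
  Vertices of the triangular graph are pairs (row, column), rows numbered downwards from 0 (the
  top vertices) and columns rightwards up to n + 1 (the right boundary vertices).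
\<close>

type_synonym vertex = "nat \<times> nat"
type_synonym arc = "vertex \<times> vertex"

definition T_edges :: "nat \<Rightarrow> vertex set set" where
  "T_edges n =
     {{(i - 1, j), (i, j)} | i j. 1 \<le> i \<and> i \<le> j \<and> j \<le> n} \<union>
     {{(i, j), (i, j + 1)} | i j. 1 \<le> i \<and> i \<le> j \<and> j \<le> n}"

text \<open>An orientation is given by its set of arcs, an arc (u, v) being directed from u to v.\<close>

definition orientations :: "vertex set set \<Rightarrow> arc set set" where
  "orientations E = {C.
     (\<forall>(u, v) \<in> C. {u, v} \<in> E) \<and>
     (\<forall>u v. {u, v} \<in> E \<longrightarrow> ((u, v) \<in> C) \<noteq> ((v, u) \<in> C))}"

definition sixV :: "nat \<Rightarrow> arc set set" where
  "sixV n = {C \<in> orientations (T_edges n).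
     (\<forall>i j. 1 \<le> i \<and> i < j \<and> j \<le> n \<longrightarrow>
        card {u. (u, (i, j)) \<in> C} = 2 \<and> card {u. ((i, j), u) \<in> C} = 2) \<and>
     (\<forall>j \<in> {1..n}. ((1, j), (0, j)) \<in> C) \<and>
     (\<forall>i \<in> {1..n}. ((i, n + 1), (i, n)) \<in> C)}"

definition vertex_entry :: "arc set \<Rightarrow> nat \<Rightarrow> nat \<Rightarrow> int" where
  "vertex_entry C i j =
    (if i = j then
       (if ((i, i), (i - 1, i)) \<in> C \<and> ((i, i + 1), (i, i)) \<in> C then 1
        else if ((i - 1, i), (i, i)) \<in> C \<and> ((i, i), (i, i + 1)) \<in> C then -1
        else 0)
     else
       (if ((i, j), (i - 1, j)) \<in> C \<and> ((i, j), (i + 1, j)) \<in> C \<and>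
           ((i, j - 1), (i, j)) \<in> C \<and> ((i, j + 1), (i, j)) \<in> C then 1
        else if ((i - 1, j), (i, j)) \<in> C \<and> ((i + 1, j), (i, j)) \<in> C \<and>
           ((i, j), (i, j - 1)) \<in> C \<and> ((i, j), (i, j + 1)) \<in> C then -1
        else 0))"

text \<open>
  Matrix indices start at 0, vertex coordinates of bulk and left boundary vertices at 1; the
  lower triangle is filled in by symmetry.
\<close>

definition mat_of_conf :: "nat \<Rightarrow> arc set \<Rightarrow> int mat" where
  "mat_of_conf n C = mat n n (\<lambda>(i, j). vertex_entry C (min i j + 1) (max i j + 1))"

text \<open>
  The inverse of the bijection \<^term>\<open>mat_of_conf n\<close> from \<^term>\<open>sixV n\<close> onto \<^term>\<open>DSASM n\<close>;
  it is meaningful only on \<^term>\<open>DSASM n\<close>.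
\<close>

definition conf_of_mat :: "nat \<Rightarrow> int mat \<Rightarrow> arc set" where
  "conf_of_mat n = the_inv_into (sixV n) (mat_of_conf n)"

text \<open>
  Interchanging the orientations, relative to the superdiagonal vertex (k - 1, k), of its edges to
  (k - 1, k - 1) and (k, k) amounts to interchanging these two diagonal vertices as the far ends of
  the arcs at (k - 1, k).
\<close>

definition swap_arc :: "nat \<Rightarrow> arc \<Rightarrow> arc" where
  "swap_arc k e = (let s = (k - 1, k); a = (k - 1, k - 1); b = (k, k) in
     if e = (a, s) then (b, s) else if e = (b, s) then (a, s)
     else if e = (s, a) then (s, b) else if e = (s, b) then (s, a)
     else e)"

definition swap_conf :: "nat \<Rightarrow> arc set \<Rightarrow> arc set" where
  "swap_conf k C = swap_arc k ` C"

definition mixed :: "arc set \<Rightarrow> nat \<Rightarrow> bool" where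
  "mixed C k \<longleftrightarrow> (((k - 1, k - 1), (k - 1, k)) \<in> C) \<noteq> (((k, k), (k - 1, k)) \<in> C)"

text \<open>
  For different k the interchanges affect disjoint pairs of edges, so the order in which they are
  carried out is immaterial. For n = 1 there are none.
\<close>

definition star_conf :: "nat \<Rightarrow> arc set \<Rightarrow> arc set" where
  "star_conf n C = fold swap_conf [2..<n + 1] C"

definition star :: "nat \<Rightarrow> int mat \<Rightarrow> int mat" where
  "star n A = mat_of_conf n (star_conf n (conf_of_mat n A))"

definition dagger :: "nat \<Rightarrow> int mat \<Rightarrow> int mat" where
  "dagger n A =
    (if star n A = A then A
     else let C = conf_of_mat n A; k = (LEAST k. k \<in> {2..n} \<and> mixed C k)
          in mat_of_conf n (swap_conf k C))"

definition star_dagger :: "nat \<Rightarrow> int mat \<Rightarrow> int mat" where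
  "star_dagger n = star n \<circ> dagger n"

definition DSASM_inv :: "(nat \<Rightarrow> int mat \<Rightarrow> int mat) \<Rightarrow> nat \<Rightarrow> int mat set" where
  "DSASM_inv \<nu> n = {A \<in> DSASM n. \<nu> n A = A}"

definition OSASM_inv :: "(nat \<Rightarrow> int mat \<Rightarrow> int mat) \<Rightarrow> nat \<Rightarrow> int mat set" where
  "OSASM_inv \<nu> n = {A \<in> OSASM n. \<nu> n A = A}"

text \<open>Finiteness, so that \<^const>\<open>card\<close> has its usual meaning on all of these sets.\<close>

lemma finite_ASM: "finite (ASM n)"
proof -
  let ?I = "{..<n} \<times> {..<n}"
  let ?F = "?I \<rightarrow>\<^sub>E {0, 1, -1 :: int}"
  have "A \<in> (\<lambda>f. mat n n f) ` ?F" if "A \<in> ASM n" for A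
  proof (rule image_eqI)
    show "A = mat n n (restrict (\<lambda>ij. A $$ ij) ?I)"
      using that by (intro eq_matI) (auto simp: ASM_def)
    show "restrict (\<lambda>ij. A $$ ij) ?I \<in> ?F"
      using that unfolding ASM_def by (intro PiE_I) auto
  qed
  moreover have "finite ?F"
    by (intro finite_PiE) auto
  ultimately show ?thesis
    by (meson finite_imageI finite_subset subsetI)
qed

lemma finite_DSASM: "finite (DSASM n)" and finite_OSASM: "finite (OSASM n)"
  using finite_ASM[of n] by (auto simp: DSASM_def OSASM_def)

end

theory Submission
  imports Defs
begin

text \<open>
  Everything is read off the corner sums H(i, j), the sums of the entries in the first i rows and the
  first j columns. A line alternates with sum 1 iff its partial sums lie in {0, 1} and end with 1, so
  alternating sign matrices of order n correspond to arrays H whose steps in both directions are 0 or 1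
  and which have the boundary values 0, i and j (\<open>ASM_iff_corner_sums\<close>); symmetric matrices have
  symmetric H. In the configuration of a symmetric matrix the orientation of every edge is one of the
  steps of H (\<open>mat_of_conf_of_corners\<close>).

  The edges at the left boundary vertices are the steps of H along the staircase (0, 0), (0, 1),
  (1, 1), (1, 2), up to (n, n). Consecutive steps that meet at (j, j + 1) differ iff the diagonal entry
  at j is nonzero; consecutive steps that meet at (j + 1, j + 1) differ iff exactly one of
  the two edges between the diagonal and the superdiagonal vertex (j + 1, j + 2) points into that
  vertex, which is then called unpaired. Hence \<^const>\<open>star\<close> and \<^const>\<open>dagger\<close> fix a matrix iff no vertex is unpaired, and
  \<^const>\<open>star_dagger\<close>, which swaps at all but the first unpaired vertex, fixes it iff at most one is
  (\<open>star_fixed_iff\<close>, \<open>dagger_fixed_iff\<close>, \<open>star_dagger_fixed_iff\<close>). Telescoping modulo 2 shows that the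
  number of nonzero diagonal entries has the parity of n and the number of unpaired vertices the
  opposite one. This already gives the zeros for even order, and leaves two counts.

  For the symmetric matrices without diagonal condition, delete the diagonal of H. What remains are the
  corner sums of a symmetric matrix B of order n - 1, and the nonzero diagonal entries of B are at the
  unpaired vertices. A deleted value of H is forced by its neighbours except at such a place, where
  there are two possibilities. So matrices with q unpaired vertices number 2 ^ q times
  the matrices of order n - 1 with q nonzero diagonal entries (\<open>card_unpaired_eq\<close>); only q = 0 and
  q = 1 occur.

  For the off-diagonally symmetric matrices, by parity, the fixed points counted are those for which
  the steps along the staircase change exactly once. Then H vanishes on the first half of the staircase
  and increases by 1 in every step of the second half. This forces all of H except on a
  square block next to the upper right corner, where H is the corner sum array of an arbitrary
  alternating sign matrix of half the order (\<open>card_one_turn\<close>).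
\<close>

section \<open>Alternating lines and corner sums\<close>

text \<open>
  Reading a list from left to right, keep the current partial sum, started at s, as a state. While the
  state is in {0, 1}, the next nonzero entry must be 1 in state 0 and -1 in state 1, which is
  1 - 2 * s. The arbitrary initial state makes the induction on the list go through.
\<close>

lemma prefix_sums_iff_alternating:
  fixes xs :: "int list" and s :: int
  assumes "set xs \<subseteq> {0, 1, -1}" and "s \<in> {0, 1}"
  shows "(\<forall>m \<le> length xs. s + sum_list (take m xs) \<in> {0, 1}) \<longleftrightarrow>
    successively (\<lambda>x y. sgn x = - sgn y) (filter (\<lambda>x. x \<noteq> 0) xs) \<and>
    (filter (\<lambda>x. x \<noteq> 0) xs \<noteq> [] \<longrightarrow> hd (filter (\<lambda>x. x \<noteq> 0) xs) = 1 - 2 * s)"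
  using assms
proof (induction xs arbitrary: s)
  case Nil
  then show ?case by simp
next
  case (Cons x xs)
  have prefix: "(\<forall>m \<le> length (x # xs). s + sum_list (take m (x # xs)) \<in> {0, 1}) \<longleftrightarrow>
      (\<forall>m \<le> length xs. (s + x) + sum_list (take m xs) \<in> {0, 1})"
    (is "?L \<longleftrightarrow> ?R")
  proof
    assume L: ?L
    show ?R
    proof (intro allI impI)
      fix m assume "m \<le> length xs"
      then show "(s + x) + sum_list (take m xs) \<in> {0, 1}"
        using L[rule_format, of "Suc m"] by (simp add: add.assoc)
    qed
  next
    assume R: ?R
    show ?L
    proof (intro allI impI)
      fix m assume "m \<le> length (x # xs)"
      then show "s + sum_list (take m (x # xs)) \<in> {0, 1}"
        using R[rule_format, of "m - 1"] Cons.prems(2) by (cases m) (simp_all add: add.assoc)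
    qed
  qed
  have xs: "set xs \<subseteq> {0, 1, -1}" and x: "x \<in> {0, 1, -1}"
    using Cons.prems by auto
  have signs: "y \<in> {1, -1}" if "filter (\<lambda>x. x \<noteq> 0) xs = y # ys" for y ys
  proof -
    have "y \<in> set (filter (\<lambda>x. x \<noteq> 0) xs)"
      using that by simp
    then show ?thesis using xs by auto
  qed
  consider "x = 0" | "x = 1 - 2 * s" | "x = 2 * s - 1"
    using x Cons.prems(2) by auto
  then show ?case
  proof cases
    case 1
    then show ?thesis
      unfolding prefix using Cons.IH[OF xs Cons.prems(2)] by simp
  next
    case 2
    then have "s + x \<in> {0, 1}" "x \<noteq> 0"
      using Cons.prems(2) by auto
    then show ?thesis
      unfolding prefix Cons.IH[OF xs \<open>s + x \<in> {0, 1}\<close>]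
      using Cons.prems(2) 2 signs
      by (cases "filter (\<lambda>x. x \<noteq> 0) xs") (fastforce simp: successively_Cons)+
  next
    case 3
    then have "s + x \<notin> {0, 1}" "x \<noteq> 0" "x \<noteq> 1 - 2 * s"
      using Cons.prems(2) by auto
    moreover from this have "\<not> (\<forall>m \<le> length xs. s + x + sum_list (take m xs) \<in> {0, 1})"
      by (auto intro!: exI[of _ 0])
    ultimately show ?thesis
      unfolding prefix by simp
  qed
qed

text \<open>
  The condition that the total is 1 replaces the condition on the sign of the first nonzero entry.
\<close>

lemma alternating_line_iff:
  assumes "\<forall>i < dim_vec v. v $ i \<in> {0, 1, -1}"
  shows "alternating_line v \<longleftrightarrow>
    (\<forall>m \<le> dim_vec v. (\<Sum>i<m. v $ i) \<in> {0, 1}) \<and> (\<Sum>i<dim_vec v. v $ i) = 1"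
proof -
  let ?xs = "list_of_vec v"
  have prefix: "sum_list (take m ?xs) = (\<Sum>i<m. v $ i)" if "m \<le> dim_vec v" for m
  proof -
    have "take m ?xs = map (($) v) [0..<m]"
      using that by (simp add: list_of_vec_map take_map)
    then show ?thesis
      by (simp add: interv_sum_list_conv_sum_set_nat atLeast0LessThan)
  qed
  have total: "sum_list ?xs = (\<Sum>i<dim_vec v. v $ i)"
    using prefix[of "dim_vec v"] by simp
  have set: "set ?xs \<subseteq> {0, 1, -1}"
    using assms by (auto simp: set_list_of_vec vec_set_def)
  let ?ys = "filter (\<lambda>x. x \<noteq> 0) ?xs"
  let ?alt = "successively (\<lambda>x y. sgn x = - sgn y) ?ys"
  have pos: "(\<forall>m \<le> dim_vec v. (\<Sum>i<m. v $ i) \<in> {0, 1}) \<longleftrightarrow> ?alt \<and> (?ys \<noteq> [] \<longrightarrow> hd ?ys = 1)"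
    using prefix_sums_iff_alternating[OF set, of 0] prefix by auto
  \<comment> \<open>A line whose first nonzero entry is -1 stays in {-1, 0} and cannot reach the total 1.\<close>
  have neg: "hd ?ys \<noteq> -1" if "?alt" "sum_list ?xs = 1"
  proof
    assume "hd ?ys = -1"
    then have "\<forall>m \<le> length ?xs. 1 + sum_list (take m ?xs) \<in> {0, 1}"
      using prefix_sums_iff_alternating[OF set, of 1] that by simp
    from this[rule_format, of "length ?xs"] that(2) show False by simp
  qed
  have "hd ?ys = 1" if "?ys \<noteq> []" "hd ?ys \<noteq> -1"
  proof -
    have "hd ?ys \<in> set ?ys"
      using that(1) by (rule hd_in_set)
    then show ?thesis using set that(2) by auto
  qed
  then show ?thesis
    unfolding alternating_line_def pos total[symmetric] using neg by blast
qed

definition corner :: "int mat \<Rightarrow> nat \<Rightarrow> nat \<Rightarrow> int" where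
  "corner A i j = (\<Sum>k<i. \<Sum>l<j. A $$ (k, l))"

text \<open>
  The corner sum arrays of the alternating sign matrices of order n.
\<close>

definition corner_sums :: "nat \<Rightarrow> (nat \<Rightarrow> nat \<Rightarrow> int) \<Rightarrow> bool" where
  "corner_sums n H \<longleftrightarrow>
    (\<forall>i \<le> n. H i 0 = 0 \<and> H 0 i = 0) \<and>
    (\<forall>i \<le> n. H i n = int i) \<and> (\<forall>j \<le> n. H n j = int j) \<and>
    (\<forall>i < n. \<forall>j \<le> n. H (Suc i) j - H i j \<in> {0, 1}) \<and>
    (\<forall>j < n. \<forall>i \<le> n. H i (Suc j) - H i j \<in> {0, 1})"

text \<open>
  The inverse of \<^const>\<open>corner\<close>: mixed second differences.
\<close>

definition mat_of_corner :: "nat \<Rightarrow> (nat \<Rightarrow> nat \<Rightarrow> int) \<Rightarrow> int mat" where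
  "mat_of_corner n H =
    mat n n (\<lambda>(i, j). H (Suc i) (Suc j) - H i (Suc j) - H (Suc i) j + H i j)"

lemma corner_0 [simp]: "corner A 0 j = 0" "corner A i 0 = 0"
  by (simp_all add: corner_def)

lemma corner_Suc: "corner A (Suc i) j = corner A i j + (\<Sum>l<j. A $$ (i, l))"
  by (simp add: corner_def)

lemma corner_Suc_right: "corner A i (Suc j) = corner A i j + (\<Sum>k<i. A $$ (k, j))"
  by (simp add: corner_def sum.distrib)

lemma entry_corner:
  "A $$ (i, j) = corner A (Suc i) (Suc j) - corner A i (Suc j) - corner A (Suc i) j + corner A i j"
  by (simp add: corner_Suc)

lemma corner_mat_of_corner:
  assumes "\<forall>i \<le> n. H i 0 = 0 \<and> H 0 i = 0" "i \<le> n" "j \<le> n"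
  shows "corner (mat_of_corner n H) i j = H i j"
  using assms(2)
proof (induction i)
  case 0
  then show ?case using assms by simp
next
  case (Suc i)
  have "(\<Sum>l<m. mat_of_corner n H $$ (i, l)) = H (Suc i) m - H i m" if "m \<le> n" for m
    using that
  proof (induction m)
    case 0
    then show ?case using assms Suc.prems by simp
  next
    case (Suc m)
    then show ?case using \<open>Suc i \<le> n\<close> by (simp add: mat_of_corner_def)
  qed
  then show ?case using Suc assms(3) by (simp add: corner_Suc)
qed

lemma mat_of_corner_carrier [simp]: "mat_of_corner n H \<in> carrier_mat n n"
  by (simp add: mat_of_corner_def)

lemma corner_eqI:
  assumes "A \<in> carrier_mat n n" "B \<in> carrier_mat n n"
    and "\<And>i j. i \<le> n \<Longrightarrow> j \<le> n \<Longrightarrow> corner A i j = corner B i j"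
  shows "A = B"
proof (rule eq_matI)
  fix i j assume "i < dim_row B" "j < dim_col B"
  then show "A $$ (i, j) = B $$ (i, j)"
    using assms by (simp add: entry_corner[of A] entry_corner[of B])
qed (use assms in auto)

lemma entry_in_signs_if_corner_sums:
  assumes "corner_sums n (corner A)" "i < n" "j < n"
  shows "A $$ (i, j) \<in> {0, 1, -1}"
proof -
  have "corner A i (Suc j) - corner A i j \<in> {0, 1}"
    "corner A (Suc i) (Suc j) - corner A (Suc i) j \<in> {0, 1}"
    using assms by (auto simp: corner_sums_def)
  then show ?thesis
    unfolding entry_corner[of A i j] by auto
qed

text \<open>
  The partial sums of row i and of column j are first differences of the corner sums, so alternation of
  all lines bounds these differences; the line totals 1 add up to the boundary values i and j.
\<close>

lemma ASM_iff_corner_sums: "A \<in> ASM n \<longleftrightarrow> A \<in> carrier_mat n n \<and> corner_sums n (corner A)"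
proof (cases "A \<in> carrier_mat n n \<and> (\<forall>i<n. \<forall>j<n. A $$ (i, j) \<in> {0, 1, -1})")
  case False
  then show ?thesis
    using entry_in_signs_if_corner_sums[of n A] by (auto simp: ASM_def)
next
  case True
  then have A: "A \<in> carrier_mat n n" and entries: "\<forall>i<n. \<forall>j<n. A $$ (i, j) \<in> {0, 1, -1}"
    by auto
  have row: "alternating_line (row A i) \<longleftrightarrow>
      (\<forall>m \<le> n. corner A (Suc i) m - corner A i m \<in> {0, 1}) \<and> corner A (Suc i) n - corner A i n = 1"
    if "i < n" for i
  proof -
    have "(\<Sum>l<m. row A i $ l) = corner A (Suc i) m - corner A i m" if "m \<le> n" for m
      using A that \<open>i < n\<close> by (simp add: corner_Suc)
    then show ?thesis
      using alternating_line_iff[of "row A i"] A entries that by simp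
  qed
  have col: "alternating_line (col A j) \<longleftrightarrow>
      (\<forall>m \<le> n. corner A m (Suc j) - corner A m j \<in> {0, 1}) \<and> corner A n (Suc j) - corner A n j = 1"
    if "j < n" for j
  proof -
    have "(\<Sum>k<m. col A j $ k) = corner A m (Suc j) - corner A m j" if "m \<le> n" for m
      using A that \<open>j < n\<close> by (simp add: corner_Suc_right)
    then show ?thesis
      using alternating_line_iff[of "col A j"] A entries that by simp
  qed
  have unit_steps: "(\<forall>i<n. f (Suc i) - f i = 1) \<longleftrightarrow> (\<forall>i\<le>n. f i = int i)" if "f 0 = 0" for f :: "nat \<Rightarrow> int"
  proof
    assume f: "\<forall>i<n. f (Suc i) - f i = 1"
    show "\<forall>i\<le>n. f i = int i"
    proof (intro allI impI)
      fix i assume "i \<le> n"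
      then show "f i = int i"
      proof (induction i)
        case (Suc i)
        then show ?case using f[rule_format, of i] by simp
      qed (use that in simp)
    qed
  qed simp
  have total: "(\<forall>i<n. corner A (Suc i) n - corner A i n = 1) \<longleftrightarrow> (\<forall>i\<le>n. corner A i n = int i)"
    "(\<forall>j<n. corner A n (Suc j) - corner A n j = 1) \<longleftrightarrow> (\<forall>j\<le>n. corner A n j = int j)"
    by (intro unit_steps; simp)+
  have "A \<in> ASM n \<longleftrightarrow>
      (\<forall>i<n. alternating_line (row A i)) \<and> (\<forall>j<n. alternating_line (col A j))"
    using A entries by (simp add: ASM_def)
  also have "(\<forall>i<n. alternating_line (row A i)) \<longleftrightarrow>
      (\<forall>i \<le> n. corner A i n = int i) \<and>
      (\<forall>i<n. \<forall>m \<le> n. corner A (Suc i) m - corner A i m \<in> {0, 1})"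
    unfolding total[symmetric] by (simp only: row cong: imp_cong) blast
  also have "(\<forall>j<n. alternating_line (col A j)) \<longleftrightarrow>
      (\<forall>j \<le> n. corner A n j = int j) \<and>
      (\<forall>j<n. \<forall>m \<le> n. corner A m (Suc j) - corner A m j \<in> {0, 1})"
    unfolding total[symmetric] by (simp only: col cong: imp_cong) blast
  finally have "A \<in> ASM n \<longleftrightarrow> corner_sums n (corner A)"
    unfolding corner_sums_def by (simp only: corner_0 simp_thms conj_ac)
  then show ?thesis using A by simp
qed

lemma corner_transpose:
  assumes "A \<in> carrier_mat n n" "i \<le> n" "j \<le> n"
  shows "corner (transpose_mat A) i j = corner A j i"
proof -
  have "corner (transpose_mat A) i j = (\<Sum>k<i. \<Sum>l<j. A $$ (l, k))"
    using assms unfolding corner_def by (intro sum.cong) auto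
  then show ?thesis
    unfolding corner_def by (subst sum.swap) simp
qed

lemma DSASM_iff_corner_sums:
  "A \<in> DSASM n \<longleftrightarrow> A \<in> carrier_mat n n \<and> corner_sums n (corner A) \<and>
    (\<forall>i\<le>n. \<forall>j\<le>n. corner A i j = corner A j i)"
proof (cases "A \<in> carrier_mat n n")
  case True
  then have "transpose_mat A = A \<longleftrightarrow> (\<forall>i\<le>n. \<forall>j\<le>n. corner A i j = corner A j i)"
    using corner_transpose[OF True] corner_eqI[of "transpose_mat A" n A]
    by (metis transpose_carrier_mat)
  then show ?thesis using True by (auto simp: DSASM_def ASM_iff_corner_sums)
qed (simp add: DSASM_def ASM_def)

section \<open>Symmetric corner sums and parity\<close>

lemma corner_sumsD:
  assumes "corner_sums n H"
  shows "i \<le> n \<Longrightarrow> H i 0 = 0" "j \<le> n \<Longrightarrow> H 0 j = 0"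
    "i \<le> n \<Longrightarrow> H i n = int i" "j \<le> n \<Longrightarrow> H n j = int j"
    "i < n \<Longrightarrow> j \<le> n \<Longrightarrow> H (Suc i) j - H i j \<in> {0, 1}"
    "i \<le> n \<Longrightarrow> j < n \<Longrightarrow> H i (Suc j) - H i j \<in> {0, 1}"
  using assms unfolding corner_sums_def by blast+

lemma DSASM_D:
  assumes "A \<in> DSASM n"
  shows "A \<in> carrier_mat n n" "corner_sums n (corner A)"
    "i \<le> n \<Longrightarrow> j \<le> n \<Longrightarrow> corner A i j = corner A j i"
  using assms unfolding DSASM_iff_corner_sums by blast+

lemma DSASM_eqI:
  assumes "A \<in> DSASM n" "B \<in> DSASM n"
    and "\<And>i j. i \<le> j \<Longrightarrow> j \<le> n \<Longrightarrow> corner A i j = corner B i j"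
  shows "A = B"
proof (rule corner_eqI)
  fix i j assume "i \<le> n" "j \<le> n"
  then show "corner A i j = corner B i j"
    using assms DSASM_D(3)[of A n i j] DSASM_D(3)[of B n i j] by (cases "i \<le> j") auto
qed (use assms DSASM_D in auto)

text \<open>
  The conditions of \<^const>\<open>corner_sums\<close> that remain visible on the triangle i \<le> j; reflecting
  such a triangle gives the corner sums of a symmetric alternating sign matrix.
\<close>

definition upper_corner_sums :: "nat \<Rightarrow> (nat \<Rightarrow> nat \<Rightarrow> int) \<Rightarrow> bool" where
  "upper_corner_sums n K \<longleftrightarrow>
    (\<forall>j \<le> n. K 0 j = 0) \<and> (\<forall>i \<le> n. K i n = int i) \<and>
    (\<forall>i j. i \<le> j \<and> j < n \<longrightarrow> K i (Suc j) - K i j \<in> {0, 1}) \<and>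
    (\<forall>i j. i < j \<and> j \<le> n \<longrightarrow> K (Suc i) j - K i j \<in> {0, 1})"

definition sym_mat :: "nat \<Rightarrow> (nat \<Rightarrow> nat \<Rightarrow> int) \<Rightarrow> int mat" where
  "sym_mat n K = mat_of_corner n (\<lambda>i j. K (min i j) (max i j))"

lemma
  assumes K: "upper_corner_sums n K"
  shows sym_mat_DSASM: "sym_mat n K \<in> DSASM n"
    and corner_sym_mat: "i \<le> j \<Longrightarrow> j \<le> n \<Longrightarrow> corner (sym_mat n K) i j = K i j"
proof -
  let ?H = "\<lambda>i j. K (min i j) (max i j)"
  have corner: "corner (sym_mat n K) i j = ?H i j" if "i \<le> n" "j \<le> n" for i j
    unfolding sym_mat_def using K that
    by (intro corner_mat_of_corner) (auto simp: upper_corner_sums_def)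
  have vertical: "?H (Suc i) j - ?H i j \<in> {0, 1}" if "i < n" "j \<le> n" for i j
  proof (cases "i < j")
    case True
    then show ?thesis using K that by (simp add: upper_corner_sums_def)
  next
    case False
    then have "K j (Suc i) - K j i \<in> {0, 1}"
      using K that by (simp add: upper_corner_sums_def)
    then show ?thesis using False by (cases "i = j") (simp_all add: max_def min_def)
  qed
  then have horizontal: "?H i (Suc j) - ?H i j \<in> {0, 1}" if "i \<le> n" "j < n" for i j
    using that by (metis max.commute min.commute)
  have "corner_sums n ?H"
    unfolding corner_sums_def using K vertical horizontal
    by (auto simp: upper_corner_sums_def min_def max_def)
  then have "corner_sums n (corner (sym_mat n K))"
    unfolding corner_sums_def using corner by simp
  then show "sym_mat n K \<in> DSASM n"
    unfolding DSASM_iff_corner_sums using corner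
    by (simp add: sym_mat_def min.commute max.commute)
  show "i \<le> j \<Longrightarrow> j \<le> n \<Longrightarrow> corner (sym_mat n K) i j = K i j"
    using corner[of i j] by simp
qed

definition diag_supp :: "nat \<Rightarrow> int mat \<Rightarrow> nat set" where
  "diag_supp n A = {j. j < n \<and> A $$ (j, j) \<noteq> 0}"

text \<open>
  The index j stands for the superdiagonal vertex (k - 1, k) with k = j + 2. Its edges to the two
  diagonal vertices are the two steps of the corner sums on the way from (j, j + 1) through
  (j + 1, j + 1) to (j + 1, j + 2); they differ iff the total increase is odd.
  See \<open>mixed_conf_of_corners\<close> below.
\<close>

definition unpaired :: "nat \<Rightarrow> int mat \<Rightarrow> nat set" where
  "unpaired n A =
    {j. Suc j < n \<and> odd (corner A (Suc j) (Suc (Suc j)) - corner A j (Suc j))}"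

lemma finite_diag_supp [simp]: "finite (diag_supp n A)"
  by (rule finite_subset[of _ "{..<n}"]) (auto simp: diag_supp_def)

lemma finite_unpaired [simp]: "finite (unpaired n A)"
  by (rule finite_subset[of _ "{..<n}"]) (auto simp: unpaired_def)

text \<open>
  By symmetry the diagonal entry at j is d - 2 * e, where d is the increase of the corner sums from
  (j, j) to (j + 1, j + 1) and e the increase from (j, j) to (j, j + 1).
\<close>

lemma diag_supp_odd:
  assumes "A \<in> DSASM n"
  shows "diag_supp n A = {j. j < n \<and> odd (corner A (Suc j) (Suc j) - corner A j j)}"
proof -
  have "A $$ (j, j) \<noteq> 0 \<longleftrightarrow> odd (corner A (Suc j) (Suc j) - corner A j j)" if "j < n" for j
  proof -
    have "corner A (Suc j) (Suc j) - corner A j j =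
        A $$ (j, j) + 2 * (corner A j (Suc j) - corner A j j)"
      using entry_corner[of A j j] DSASM_D(3)[OF assms, of "Suc j" j] that by simp
    then have "odd (corner A (Suc j) (Suc j) - corner A j j) \<longleftrightarrow>
        odd (A $$ (j, j) + 2 * (corner A j (Suc j) - corner A j j))"
      by (simp only:)
    also have "\<dots> \<longleftrightarrow> odd (A $$ (j, j))"
      by simp
    finally have "odd (corner A (Suc j) (Suc j) - corner A j j) \<longleftrightarrow> odd (A $$ (j, j))" .
    moreover have "A $$ (j, j) \<in> {0, 1, -1}"
      using entry_in_signs_if_corner_sums DSASM_D(2)[OF assms] that by blast
    ultimately show ?thesis by auto
  qed
  then show ?thesis unfolding diag_supp_def by blast
qed

lemma diag_step:
  assumes "A \<in> DSASM n" "j < n"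
  shows "corner A (Suc j) (Suc j) - corner A j j \<in> {0, 1, 2}"
  using corner_sumsD(5)[OF DSASM_D(2)[OF assms(1)], of j "Suc j"]
    corner_sumsD(6)[OF DSASM_D(2)[OF assms(1)], of j j] assms(2) by auto

lemma diag_supp_eq:
  assumes "A \<in> DSASM n"
  shows "diag_supp n A = {j. j < n \<and> corner A (Suc j) (Suc j) - corner A j j = 1}"
proof -
  have "odd d \<longleftrightarrow> d = 1" if "d \<in> {0, 1, 2}" for d :: int
    using that by auto
  from this[OF diag_step[OF assms]] show ?thesis
    unfolding diag_supp_odd[OF assms] by blast
qed

text \<open>
  Modulo 2, the number of odd increments is the telescoping sum of all increments.
\<close>

lemma even_card_odd_steps:
  fixes f :: "nat \<Rightarrow> int"
  shows "even (card {j. j < n \<and> odd (f (Suc j) - f j)}) \<longleftrightarrow> even (f n - f 0)"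
proof (induction n)
  case 0
  then show ?case by simp
next
  case (Suc n)
  have "{j. j < Suc n \<and> odd (f (Suc j) - f j)} =
    (if odd (f (Suc n) - f n) then insert n {j. j < n \<and> odd (f (Suc j) - f j)}
     else {j. j < n \<and> odd (f (Suc j) - f j)})"
    by (auto simp: less_Suc_eq)
  then show ?case using Suc by auto
qed

lemma even_card_diag_supp:
  assumes "A \<in> DSASM n"
  shows "even (card (diag_supp n A)) \<longleftrightarrow> even n"
  using even_card_odd_steps[of n "\<lambda>j. corner A j j"] corner_sumsD(3)[OF DSASM_D(2)[OF assms], of n]
  unfolding diag_supp_odd[OF assms] by simp

lemma even_card_unpaired:
  assumes "A \<in> DSASM n" "n \<ge> 1"
  shows "even (card (unpaired n A)) \<longleftrightarrow> odd n"
proof -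
  obtain m where n: "n = Suc m" using assms(2) by (cases n) auto
  show ?thesis
    using even_card_odd_steps[of m "\<lambda>j. corner A j (Suc j)"]
      corner_sumsD(3)[OF DSASM_D(2)[OF assms(1)], of m]
    unfolding unpaired_def by (simp add: n)
qed

section \<open>Removing the left boundary vertices\<close>

text \<open>
  Deleting the diagonal of a symmetric corner sum array of order n + 1 and shifting the remaining
  triangle by one column leaves a corner sum array of order n. In the triangular graph, the left
  boundary vertices are deleted and the superdiagonal vertices take their place.
\<close>

definition shrink :: "nat \<Rightarrow> int mat \<Rightarrow> int mat" where
  "shrink n A = sym_mat n (\<lambda>i j. corner A i (Suc j))"

text \<open>
  The inverse of \<^const>\<open>shrink\<close> has to restore the diagonal of the corner sums. Its value at (j, j)
  lies between the neighbours at (j - 1, j) and (j, j + 1), which are the corner sums of B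
  at (j - 1, j - 1) and (j, j), and differs from each by at most 1. If these two differ by 0 or 2, the
  value is forced; if they differ by 1, that is, if j - 1 is in the diagonal support of B, both values
  are possible, and S records the choice of the larger one. The last diagonal value is the boundary value n + 1.
\<close>

definition grow :: "nat \<Rightarrow> int mat \<Rightarrow> nat set \<Rightarrow> int mat" where
  "grow n B S = sym_mat (Suc n) (\<lambda>i j.
    if i < j then corner B i (j - 1) else if j = 0 then 0 else if j = Suc n then int (Suc n)
    else corner B (j - 1) (j - 1) + (corner B j j - corner B (j - 1) (j - 1)) div 2 +
      of_bool (j - 1 \<in> S))"

lemma
  assumes "A \<in> DSASM (Suc n)"
  shows shrink_DSASM: "shrink n A \<in> DSASM n"
    and corner_shrink: "i \<le> j \<Longrightarrow> j \<le> n \<Longrightarrow> corner (shrink n A) i j = corner A i (Suc j)"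
proof -
  have "upper_corner_sums n (\<lambda>i j. corner A i (Suc j))"
    using corner_sumsD[OF DSASM_D(2)[OF assms]] unfolding upper_corner_sums_def by auto
  then show "shrink n A \<in> DSASM n"
    and "i \<le> j \<Longrightarrow> j \<le> n \<Longrightarrow> corner (shrink n A) i j = corner A i (Suc j)"
    unfolding shrink_def by (simp_all add: sym_mat_DSASM corner_sym_mat)
qed

lemma diag_supp_shrink:
  assumes "A \<in> DSASM (Suc n)"
  shows "diag_supp n (shrink n A) = unpaired (Suc n) A"
  unfolding diag_supp_odd[OF shrink_DSASM[OF assms]] unpaired_def
  using corner_shrink[OF assms] by auto

lemma
  assumes B: "B \<in> DSASM n" and S: "S \<subseteq> diag_supp n B"
  shows grow_DSASM: "grow n B S \<in> DSASM (Suc n)"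
    and corner_grow: "i \<le> j \<Longrightarrow> j \<le> n \<Longrightarrow> corner (grow n B S) i (Suc j) = corner B i j"
    and corner_grow_diag: "j < n \<Longrightarrow> corner (grow n B S) (Suc j) (Suc j) =
      corner B j j + (corner B (Suc j) (Suc j) - corner B j j) div 2 + of_bool (j \<in> S)"
proof -
  define K where "K = (\<lambda>i j. if i < j then corner B i (j - 1) else if j = 0 then 0
    else if j = Suc n then int (Suc n)
    else corner B (j - 1) (j - 1) + (corner B j j - corner B (j - 1) (j - 1)) div 2 +
      of_bool (j - 1 \<in> S))"
  note H = corner_sumsD[OF DSASM_D(2)[OF B]]
  have even_outside: "j \<notin> S" if "corner B (Suc j) (Suc j) - corner B j j \<in> {0, 2}" for j
    using S that unfolding diag_supp_eq[OF B] by auto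
  have diag: "K (Suc j) (Suc j) - corner B j j \<in> {0, 1} \<and>
      corner B (Suc j) (Suc j) - K (Suc j) (Suc j) \<in> {0, 1}" if "j < n" for j
    using diag_step[OF B that] even_outside[of j] that unfolding K_def by auto
  have "K i (Suc j) - K i j \<in> {0, 1}" if "i \<le> j" "j < Suc n" for i j
  proof (cases "i < j")
    case True
    then show ?thesis using H(6)[of i "j - 1"] that by (simp add: K_def)
  next
    case False
    then have "i = j" using that by simp
    show ?thesis
    proof (cases j)
      case 0
      then show ?thesis using \<open>i = j\<close> by (simp add: K_def)
    next
      case (Suc j')
      have "K i (Suc j) = corner B j j" using \<open>i = j\<close> by (simp add: K_def)
      then show ?thesis using diag[of j'] Suc that \<open>i = j\<close> by simp
    qed
  qed
  moreover have "K (Suc i) j - K i j \<in> {0, 1}" if "i < j" "j \<le> Suc n" for i j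
  proof (cases "Suc i < j")
    case True
    then show ?thesis using H(5)[of i "j - 1"] that by (simp add: K_def)
  next
    case False
    then have j: "j = Suc i" using that by simp
    have Ki: "K i j = corner B i i" by (simp add: K_def j)
    show ?thesis
    proof (cases "i = n")
      case True
      then show ?thesis using H(3)[of n] Ki j by (simp add: K_def)
    next
      case False
      then show ?thesis using diag[of i] Ki j that by simp
    qed
  qed
  ultimately have K: "upper_corner_sums (Suc n) K"
    unfolding upper_corner_sums_def using H(3) by (auto simp: K_def)
  have grow: "grow n B S = sym_mat (Suc n) K"
    unfolding grow_def K_def ..
  show "grow n B S \<in> DSASM (Suc n)"
    unfolding grow using K by (rule sym_mat_DSASM)
  show "i \<le> j \<Longrightarrow> j \<le> n \<Longrightarrow> corner (grow n B S) i (Suc j) = corner B i j"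
    unfolding grow using corner_sym_mat[OF K, of i "Suc j"] by (simp add: K_def)
  show "j < n \<Longrightarrow> corner (grow n B S) (Suc j) (Suc j) =
      corner B j j + (corner B (Suc j) (Suc j) - corner B j j) div 2 + of_bool (j \<in> S)"
    unfolding grow using corner_sym_mat[OF K, of "Suc j" "Suc j"] by (simp add: K_def)
qed

lemma shrink_grow:
  assumes "B \<in> DSASM n" "S \<subseteq> diag_supp n B"
  shows "shrink n (grow n B S) = B"
  using assms grow_DSASM[OF assms]
  by (intro DSASM_eqI[of _ n]) (simp_all add: shrink_DSASM corner_shrink corner_grow)

text \<open>
  The choice S that \<^const>\<open>grow\<close> needs in order to recover A from \<open>shrink n A\<close>.
\<close>

definition raised :: "nat \<Rightarrow> int mat \<Rightarrow> nat set" where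
  "raised n A = {j \<in> unpaired n A. corner A (Suc j) (Suc j) \<noteq> corner A j (Suc j)}"

lemma raised_grow:
  assumes "B \<in> DSASM n" "S \<subseteq> diag_supp n B"
  shows "raised (Suc n) (grow n B S) = S"
proof -
  have "unpaired (Suc n) (grow n B S) = diag_supp n B"
    using diag_supp_shrink[OF grow_DSASM[OF assms]] shrink_grow[OF assms] by simp
  moreover have "corner (grow n B S) (Suc j) (Suc j) \<noteq> corner (grow n B S) j (Suc j) \<longleftrightarrow> j \<in> S"
    if "j \<in> diag_supp n B" for j
  proof -
    have "j < n" "corner B (Suc j) (Suc j) - corner B j j = 1"
      using that unfolding diag_supp_eq[OF assms(1)] by auto
    then show ?thesis
      using corner_grow_diag[OF assms \<open>j < n\<close>] corner_grow[OF assms, of j j] \<open>j < n\<close> by simp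
  qed
  ultimately show ?thesis using assms(2) unfolding raised_def by blast
qed

lemma grow_shrink:
  assumes A: "A \<in> DSASM (Suc n)"
  shows "grow n (shrink n A) (raised (Suc n) A) = A"
proof (rule DSASM_eqI)
  have S: "raised (Suc n) A \<subseteq> diag_supp n (shrink n A)"
    unfolding diag_supp_shrink[OF A] raised_def by blast
  note B = shrink_DSASM[OF A]
  show G: "grow n (shrink n A) (raised (Suc n) A) \<in> DSASM (Suc n)"
    using B S by (rule grow_DSASM)
  note H = corner_sumsD[OF DSASM_D(2)[OF A]]
  fix i j assume ij: "i \<le> j" "j \<le> Suc n"
  show "corner (grow n (shrink n A) (raised (Suc n) A)) i j = corner A i j"
  proof (cases j)
    case 0
    then show ?thesis by simp
  next
    case (Suc j')
    show ?thesis
    proof (cases "i = j")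
      case False
      then show ?thesis using Suc ij corner_grow[OF B S, of i j'] corner_shrink[OF A, of i j'] by simp
    next
      case True
      show ?thesis
      proof (cases "j' = n")
        case True
        then show ?thesis
          using \<open>i = j\<close> Suc corner_sumsD(3)[OF DSASM_D(2)[OF G], of "Suc n"] H(3)[of "Suc n"] by simp
      next
        case False
        then have "j' < n" using Suc ij by simp
        let ?x = "corner A (Suc j') (Suc j') - corner A j' (Suc j')"
        let ?y = "corner A (Suc j') (Suc (Suc j')) - corner A (Suc j') (Suc j')"
        have xy: "?x \<in> {0, 1}" "?y \<in> {0, 1}"
          using H(5)[of j' "Suc j'"] H(6)[of "Suc j'" "Suc j'"] \<open>j' < n\<close> by auto
        \<comment> \<open>x and y are the steps into and out of (j, j) in A; a lone step x = 1 is what \<open>raised\<close> records\<close>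
        have carry: "(x + y) div 2 + of_bool (odd (x + y) \<and> x \<noteq> 0) = x"
          if "x \<in> {0, 1}" "y \<in> {0, 1}" for x y :: int
          using that by auto
        have raised: "j' \<in> raised (Suc n) A \<longleftrightarrow> odd (?x + ?y) \<and> ?x \<noteq> 0"
          using \<open>j' < n\<close> by (auto simp: raised_def unpaired_def)
        have "corner (grow n (shrink n A) (raised (Suc n) A)) i j =
            corner A j' (Suc j') + ((?x + ?y) div 2 + of_bool (j' \<in> raised (Suc n) A))"
          using corner_grow_diag[OF B S \<open>j' < n\<close>] corner_shrink[OF A, of j' j']
            corner_shrink[OF A, of "Suc j'" "Suc j'"] \<open>j' < n\<close> \<open>i = j\<close> Suc by simp
        also have "(?x + ?y) div 2 + of_bool (j' \<in> raised (Suc n) A) = ?x"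
          unfolding raised by (rule carry[OF xy])
        finally show ?thesis using \<open>i = j\<close> Suc by simp
      qed
    qed
  qed
qed (rule A)

text \<open>
  Each B of order n is the image under \<^const>\<open>shrink\<close> of one matrix for every subset of its diagonal
  support, and that support is the set of unpaired vertices of all these matrices.
\<close>

lemma card_unpaired_eq:
  "card {A \<in> DSASM (Suc n). card (unpaired (Suc n) A) = q} =
    2 ^ q * card {B \<in> DSASM n. card (diag_supp n B) = q}"
proof -
  let ?L = "{A \<in> DSASM (Suc n). card (unpaired (Suc n) A) = q}"
  let ?R = "{B \<in> DSASM n. card (diag_supp n B) = q}"
  have "bij_betw (\<lambda>A. (shrink n A, raised (Suc n) A)) ?L (SIGMA B:?R. Pow (diag_supp n B))"
  proof (rule bij_betw_byWitness[where f' = "\<lambda>(B, S). grow n B S"])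
    show "\<forall>A\<in>?L. (\<lambda>(B, S). grow n B S) (shrink n A, raised (Suc n) A) = A"
      by (simp add: grow_shrink)
    show "\<forall>p\<in>(SIGMA B:?R. Pow (diag_supp n B)).
        (\<lambda>A. (shrink n A, raised (Suc n) A)) ((\<lambda>(B, S). grow n B S) p) = p"
      by (auto simp: shrink_grow raised_grow)
    show "(\<lambda>A. (shrink n A, raised (Suc n) A)) ` ?L \<subseteq> (SIGMA B:?R. Pow (diag_supp n B))"
      by (auto simp: shrink_DSASM diag_supp_shrink raised_def)
    show "(\<lambda>(B, S). grow n B S) ` (SIGMA B:?R. Pow (diag_supp n B)) \<subseteq> ?L"
    proof clarify
      fix B S assume "B \<in> DSASM n" "S \<subseteq> diag_supp n B"
      then show "grow n B S \<in> DSASM (Suc n) \<and>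
          card (unpaired (Suc n) (grow n B S)) = card (diag_supp n B)"
        using diag_supp_shrink[OF grow_DSASM, of B n S] by (simp add: grow_DSASM shrink_grow)
    qed
  qed
  then have "card ?L = card (SIGMA B:?R. Pow (diag_supp n B))"
    by (rule bij_betw_same_card)
  also have "\<dots> = (\<Sum>B\<in>?R. card (Pow (diag_supp n B)))"
    using finite_DSASM[of n] by (intro card_SigmaI) auto
  also have "\<dots> = (\<Sum>B\<in>?R. 2 ^ q)"
    by (intro sum.cong) (auto simp: card_Pow)
  finally show ?thesis by (simp add: mult.commute)
qed

section \<open>Matrices with a single turn along the staircase\<close>

text \<open>
  The increments of S start with 0, end with 1, and change only once, so they are a block of zeros
  followed by a block of ones; the end value N, reached after 2 * N steps, makes the blocks equally
  long.
\<close>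

lemma single_turn_iff:
  fixes S :: "nat \<Rightarrow> int"
  assumes N: "N \<ge> 1"
    and ends: "S 0 = 0" "S 1 = 0" "S (2 * N - 1) = int N - 1" "S (2 * N) = int N"
    and steps: "\<And>m. m < 2 * N \<Longrightarrow> S (Suc m) - S m \<in> {0, 1}"
  shows "card {m. m + 2 \<le> 2 * N \<and> odd (S (m + 2) - S m)} = 1 \<longleftrightarrow>
    (\<forall>m \<le> 2 * N. S m = max 0 (int m - int N))"
proof
  define t where "t = (\<lambda>m. S (Suc m) - S m)"
  have turn: "odd (S (m + 2) - S m) \<longleftrightarrow> t (Suc m) \<noteq> t m" if "m + 2 \<le> 2 * N" for m
  proof -
    have "odd (x + y) \<longleftrightarrow> x \<noteq> y" if "x \<in> {0, 1}" "y \<in> {0, 1}" for x y :: int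
      using that by auto
    moreover have "t (Suc m) \<in> {0, 1}" "t m \<in> {0, 1}"
      using steps[of m] steps[of "Suc m"] that unfolding t_def by auto
    ultimately have "odd (t (Suc m) + t m) \<longleftrightarrow> t (Suc m) \<noteq> t m" by blast
    moreover have "t (Suc m) + t m = S (m + 2) - S m" by (simp add: t_def)
    ultimately show ?thesis by (simp only:)
  qed
  assume "card {m. m + 2 \<le> 2 * N \<and> odd (S (m + 2) - S m)} = 1"
  then obtain p where "{m. m + 2 \<le> 2 * N \<and> odd (S (m + 2) - S m)} = {p}"
    by (rule card_1_singletonE)
  then have turns: "m + 2 \<le> 2 * N \<and> odd (S (m + 2) - S m) \<longleftrightarrow> m = p" for m
    by blast
  have p: "p + 2 \<le> 2 * N" using turns by blast
  have t: "t m = of_bool (p < m)" if "m < 2 * N" for m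
    using that
  proof (induction m)
    case 0
    then show ?case using ends by (simp add: t_def)
  next
    case (Suc m)
    have "t (Suc m) \<in> {0, 1}" using steps[OF Suc.prems] by (simp add: t_def)
    moreover have "t (Suc m) \<noteq> t m \<longleftrightarrow> m = p"
      using turn[of m] turns[of m] Suc.prems by auto
    moreover have "t m = of_bool (p < m)"
      using Suc by simp
    ultimately show ?case by (cases "m = p") (auto simp: less_Suc_eq)
  qed
  have S: "S m = max 0 (int m - int (Suc p))" if "m \<le> 2 * N" for m
    using that
  proof (induction m)
    case 0
    then show ?case using ends by simp
  next
    case (Suc m)
    have "S (Suc m) = S m + t m" by (simp add: t_def)
    then show ?case using Suc t[of m] by auto
  qed
  \<comment> \<open>comparison of the end values locates the turn at p = N - 1\<close>
  from S[of "2 * N"] have "Suc p = N" using ends p by auto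
  then show "\<forall>m \<le> 2 * N. S m = max 0 (int m - int N)"
    using S by blast
next
  assume S: "\<forall>m \<le> 2 * N. S m = max 0 (int m - int N)"
  have "m + 2 \<le> 2 * N \<and> odd (S (m + 2) - S m) \<longleftrightarrow> m = N - 1" for m
  proof (cases "m + 2 \<le> 2 * N")
    case True
    then have "S (m + 2) - S m = max 0 (int m + 2 - int N) - max 0 (int m - int N)"
      using S by simp
    also have "\<dots> = (if m + 2 \<le> N then 0 else if m + 1 = N then 1 else 2)"
      by auto
    finally show ?thesis using N True by auto
  next
    case False
    then show ?thesis using N by auto
  qed
  then have "{m. m + 2 \<le> 2 * N \<and> odd (S (m + 2) - S m)} = {N - 1}"
    by blast
  then show "card {m. m + 2 \<le> 2 * N \<and> odd (S (m + 2) - S m)} = 1"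
    by simp
qed

text \<open>
  The corner sums along the staircase (0, 0), (0, 1), (1, 1), (1, 2), (2, 2) and so on.
\<close>

definition stair :: "int mat \<Rightarrow> nat \<Rightarrow> int" where
  "stair A m = corner A (m div 2) (Suc m div 2)"

text \<open>
  A change between the two steps that meet at (j, j + 1) is a nonzero diagonal entry, and a change
  between the two steps that meet at (j + 1, j + 1) is an unpaired superdiagonal vertex.
\<close>

lemma card_turns:
  assumes "A \<in> DSASM N"
  shows "card {m. m + 2 \<le> 2 * N \<and> odd (stair A (m + 2) - stair A m)} =
    card (diag_supp N A) + card (unpaired N A)"
proof -
  let ?T = "{m. m + 2 \<le> 2 * N \<and> odd (stair A (m + 2) - stair A m)}"
  have even: "2 * j \<in> ?T \<longleftrightarrow> j \<in> diag_supp N A" for j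
    unfolding diag_supp_odd[OF assms] by (auto simp: stair_def)
  have odd: "Suc (2 * j) \<in> ?T \<longleftrightarrow> j \<in> unpaired N A" for j
    unfolding unpaired_def by (auto simp: stair_def)
  have "?T = (\<lambda>j. 2 * j) ` diag_supp N A \<union> (\<lambda>j. Suc (2 * j)) ` unpaired N A" (is "_ = ?E \<union> ?O")
  proof (intro equalityI subsetI)
    fix m assume "m \<in> ?T"
    then show "m \<in> ?E \<union> ?O"
      using even[of "m div 2"] odd[of "m div 2"] by (cases "even m") (auto elim!: evenE oddE)
  next
    fix m assume "m \<in> ?E \<union> ?O"
    then show "m \<in> ?T" using even odd by blast
  qed
  moreover have "?E \<inter> ?O = {}"
    by auto presburger
  ultimately show ?thesis
    by (simp add: card_Un_disjoint card_image inj_on_def)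
qed

lemma one_turn_iff_stair:
  assumes A: "A \<in> DSASM N" and N: "N \<ge> 1"
  shows "card (diag_supp N A) + card (unpaired N A) = 1 \<longleftrightarrow>
    (\<forall>m \<le> 2 * N. stair A m = max 0 (int m - int N))"
  unfolding card_turns[OF A, symmetric]
proof (rule single_turn_iff[OF N])
  note H = corner_sumsD[OF DSASM_D(2)[OF A]]
  show "stair A 0 = 0" "stair A 1 = 0" by (simp_all add: stair_def)
  have "(2 * N - 1) div 2 = N - 1" "Suc (2 * N - 1) div 2 = N" using N by presburger+
  then show "stair A (2 * N - 1) = int N - 1"
    using H(3)[of "N - 1"] N by (simp add: stair_def)
  show "stair A (2 * N) = int N"
    using H(3)[of N] by (simp add: stair_def)
  fix m assume "m < 2 * N"
  show "stair A (Suc m) - stair A m \<in> {0, 1}"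
  proof (cases "even m")
    case True
    then obtain j where "m = 2 * j" by (rule evenE)
    then show ?thesis using H(6)[of j j] \<open>m < 2 * N\<close> by (simp add: stair_def)
  next
    case False
    then obtain j where "m = Suc (2 * j)" by (metis oddE Suc_eq_plus1)
    then show ?thesis using H(5)[of j "Suc j"] \<open>m < 2 * N\<close> by (simp add: stair_def)
  qed
qed

lemma corner_sums_step_right:
  assumes "corner_sums n H" "i \<le> n" "j \<le> j'" "j' \<le> n"
  shows "H i j \<le> H i j'" "H i j' \<le> H i j + int (j' - j)"
proof -
  have "H i j \<le> H i (j + k) \<and> H i (j + k) \<le> H i j + int k" if "j + k \<le> n" for k
    using that
  proof (induction k)
    case (Suc k)
    then show ?case using corner_sumsD(6)[OF assms(1), of i "j + k"] assms(2) by auto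
  qed simp
  from this[of "j' - j"] show "H i j \<le> H i j'" "H i j' \<le> H i j + int (j' - j)"
    using assms by auto
qed

lemma corner_sums_step_down:
  assumes "corner_sums n H" "j \<le> n" "i \<le> i'" "i' \<le> n"
  shows "H i j \<le> H i' j" "H i' j \<le> H i j + int (i' - i)"
proof -
  have "corner_sums n (\<lambda>i j. H j i)"
    using assms(1) unfolding corner_sums_def by blast
  from corner_sums_step_right[OF this assms(2-4)]
  show "H i j \<le> H i' j" "H i' j \<le> H i j + int (i' - i)" by auto
qed

text \<open>
  The staircase value at m = N is the corner sum at (n, c), next to the centre of the matrix. If it
  vanishes, monotonicity gives zero corner sums above and to the left. As H(n, N) = n, the n steps
  from (n, c) to (n, N) must all be 1, and below that row the corner sums are squeezed
  between the values given by steps at most 1 from (n, j) and from (N, j).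
\<close>

lemma corner_if_stair:
  assumes A: "A \<in> DSASM N" and stair: "stair A N = 0"
    and N: "n = N div 2" "c = Suc N div 2"
  shows "i \<le> n \<Longrightarrow> j \<le> c \<Longrightarrow> corner A i j = 0"
    and "n \<le> i \<Longrightarrow> i \<le> N \<Longrightarrow> c \<le> j \<Longrightarrow> j \<le> N \<Longrightarrow> corner A i j = int i + int j - int N"
proof -
  note cs = DSASM_D(2)[OF A]
  have nc: "n + c = N" "n \<le> c" "c \<le> Suc n" using N by presburger+
  have zero: "corner A n c = 0" using stair N by (simp add: stair_def)
  show "corner A i j = 0" if "i \<le> n" "j \<le> c"
  proof -
    have "corner A i j \<le> corner A i c" "corner A i c \<le> corner A n c" "corner A i 0 \<le> corner A i j"
      using corner_sums_step_right(1)[OF cs, of i j c] corner_sums_step_down(1)[OF cs, of c i n]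
        corner_sums_step_right(1)[OF cs, of i 0 j] that nc by auto
    then show ?thesis using zero by simp
  qed
  show "corner A i j = int i + int j - int N" if "n \<le> i" "i \<le> N" "c \<le> j" "j \<le> N"
  proof -
    have "corner A n j \<le> int (j - c)" "corner A i j \<le> corner A n j + int (i - n)"
      "corner A N j \<le> corner A i j + int (N - i)" "corner A N j = int j"
      using corner_sums_step_right(2)[OF cs, of n c j] corner_sums_step_down(2)[OF cs, of j n i]
        corner_sums_step_down(2)[OF cs, of j i N] corner_sumsD(4)[OF cs, of j] that nc zero by auto
    then show ?thesis using that nc by auto
  qed
qed

text \<open>
  In a matrix with a single turn only the upper right block, of order N div 2, is undetermined. It is
  a full square, on which the
  symmetry imposes no condition, so it is an arbitrary alternating sign matrix M. For even N the
  whole matrix consists of the blocks 0, M, the transpose of M and 0; for odd N there is in addition a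
  central row and column with a single 1 in the centre.
\<close>

definition fold_block :: "nat \<Rightarrow> int mat \<Rightarrow> int mat" where
  "fold_block N A = mat_of_corner (N div 2) (\<lambda>i j. corner A i (Suc N div 2 + j))"

definition unfold_block :: "nat \<Rightarrow> int mat \<Rightarrow> int mat" where
  "unfold_block N M = sym_mat N (\<lambda>i j.
    if i \<le> N div 2 then corner M i (j - Suc N div 2) else int i + int j - int N)"

lemma
  assumes A: "A \<in> DSASM N" and stair: "stair A N = 0"
  shows fold_block_ASM: "fold_block N A \<in> ASM (N div 2)"
    and corner_fold_block: "i \<le> N div 2 \<Longrightarrow> j \<le> N div 2 \<Longrightarrow>
      corner (fold_block N A) i j = corner A i (Suc N div 2 + j)"
proof -
  define n c where N: "n = N div 2" "c = Suc N div 2"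
  have nc: "n + c = N" "n \<le> c" using N by presburger+
  note cs = corner_sumsD[OF DSASM_D(2)[OF A]]
  note block = corner_if_stair[OF A stair N]
  have corner: "corner (fold_block N A) i j = corner A i (c + j)" if "i \<le> n" "j \<le> n" for i j
    unfolding fold_block_def N[symmetric] using block(1) that by (intro corner_mat_of_corner) auto
  have "corner_sums n (corner (fold_block N A))"
    unfolding corner_sums_def
  proof (intro conjI allI impI)
    fix i assume "i \<le> n"
    show "corner (fold_block N A) i n = int i"
      using corner cs(3)[of i] \<open>i \<le> n\<close> nc by (simp add: add.commute)
    show "corner (fold_block N A) n i = int i"
      using corner block(2)[of n "c + i"] \<open>i \<le> n\<close> nc by auto
  next
    fix i j assume "i < n" "j \<le> n"
    then show "corner (fold_block N A) (Suc i) j - corner (fold_block N A) i j \<in> {0, 1}"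
      using corner[of i j] corner[of "Suc i" j] cs(5)[of i "c + j"] nc by simp
  next
    fix j i assume "j < n" "i \<le> n"
    then show "corner (fold_block N A) i (Suc j) - corner (fold_block N A) i j \<in> {0, 1}"
      using corner[of i j] corner[of i "Suc j"] cs(6)[of i "c + j"] nc by simp
  qed simp_all
  then show "fold_block N A \<in> ASM (N div 2)"
    unfolding ASM_iff_corner_sums N by (simp add: fold_block_def)
  show "i \<le> N div 2 \<Longrightarrow> j \<le> N div 2 \<Longrightarrow>
      corner (fold_block N A) i j = corner A i (Suc N div 2 + j)"
    using corner N by simp
qed

lemma
  assumes M: "M \<in> ASM (N div 2)"
  shows unfold_block_DSASM: "unfold_block N M \<in> DSASM N"
    and corner_unfold_block: "i \<le> j \<Longrightarrow> j \<le> N \<Longrightarrow> corner (unfold_block N M) i j =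
      (if i \<le> N div 2 then corner M i (j - Suc N div 2) else int i + int j - int N)"
proof -
  define n c where N: "n = N div 2" "c = Suc N div 2"
  have nc: "n + c = N" "n \<le> c" "c \<le> Suc n" using N by presburger+
  have "corner_sums n (corner M)"
    using M unfolding ASM_iff_corner_sums N by blast
  note cs = corner_sumsD[OF this]
  define K where "K = (\<lambda>i j. if i \<le> n then corner M i (j - c) else int i + int j - int N)"
  have unfold: "unfold_block N M = sym_mat N K"
    unfolding unfold_block_def K_def N ..
  have "K i (Suc j) - K i j \<in> {0, 1}" if "i \<le> j" "j < N" for i j
  proof (cases "c \<le> j")
    case True
    then show ?thesis using cs(6)[of i "j - c"] that nc by (auto simp: K_def Suc_diff_le)
  next
    case False
    then show ?thesis by (simp add: K_def)
  qed
  moreover have "K (Suc i) j - K i j \<in> {0, 1}" if "i < j" "j \<le> N" for i j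
  proof -
    consider "i < n" | "i = n" | "n < i" by linarith
    then show ?thesis
    proof cases
      case 1
      then show ?thesis using cs(5)[of i "j - c"] that nc by (simp add: K_def)
    next
      case 2
      have "c \<le> j" using 2 that nc by simp
      then show ?thesis using 2 cs(4)[of "j - c"] that nc by (simp add: K_def)
    qed (simp add: K_def)
  qed
  moreover have "K i N = int i" if "i \<le> N" for i
    using cs(3)[of i] nc by (auto simp: K_def)
  ultimately have K: "upper_corner_sums N K"
    unfolding upper_corner_sums_def by (auto simp: K_def)
  show "unfold_block N M \<in> DSASM N"
    unfolding unfold using K by (rule sym_mat_DSASM)
  show "i \<le> j \<Longrightarrow> j \<le> N \<Longrightarrow> corner (unfold_block N M) i j =
      (if i \<le> N div 2 then corner M i (j - Suc N div 2) else int i + int j - int N)"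
    unfolding unfold using corner_sym_mat[OF K] by (simp add: K_def N)
qed

lemma stair_unfold_block:
  assumes M: "M \<in> ASM (N div 2)" and N: "N \<ge> 1" and m: "m \<le> 2 * N"
  shows "stair (unfold_block N M) m = max 0 (int m - int N)"
proof -
  have "corner_sums (N div 2) (corner M)"
    using M unfolding ASM_iff_corner_sums by blast
  note cs = corner_sumsD[OF this]
  have "m div 2 \<le> Suc m div 2" "Suc m div 2 \<le> N" "m div 2 + Suc m div 2 = m"
    using m by presburger+
  then have eq: "stair (unfold_block N M) m =
      (if m div 2 \<le> N div 2 then corner M (m div 2) (Suc m div 2 - Suc N div 2) else int m - int N)"
    unfolding stair_def using corner_unfold_block[OF M, of "m div 2" "Suc m div 2"] by simp
  have "N div 2 < m div 2 \<or> m div 2 \<le> N div 2 \<and> m \<le> N \<or> m = Suc N \<and> even N"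
    by presburger
  then consider "N div 2 < m div 2" | "m div 2 \<le> N div 2" "m \<le> N" | "m = Suc N" "even N"
    by blast
  then show ?thesis
  proof cases
    case 1
    moreover from 1 have "N < m" by presburger
    ultimately show ?thesis unfolding eq by simp
  next
    case 2
    moreover from 2 have "Suc m div 2 \<le> Suc N div 2" by presburger
    ultimately show ?thesis unfolding eq by simp
  next
    case 3
    then have "m div 2 = N div 2" "Suc m div 2 - Suc N div 2 = 1" "1 \<le> N div 2"
      using N by presburger+
    then show ?thesis unfolding eq using 3 cs(4)[of 1] by simp
  qed
qed

lemma card_one_turn:
  assumes N: "N \<ge> 1"
  shows "card {A \<in> DSASM N. card (diag_supp N A) + card (unpaired N A) = 1} = card (ASM (N div 2))"
proof -
  let ?L = "{A \<in> DSASM N. card (diag_supp N A) + card (unpaired N A) = 1}"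
  have L: "A \<in> ?L \<longleftrightarrow> A \<in> DSASM N \<and> (\<forall>m \<le> 2 * N. stair A m = max 0 (int m - int N))" for A
    using one_turn_iff_stair[OF _ N] by blast
  then have L0: "stair A N = 0" if "A \<in> ?L" for A
    using that by simp
  have "bij_betw (fold_block N) ?L (ASM (N div 2))"
  proof (rule bij_betw_byWitness[where f' = "unfold_block N"])
    show "fold_block N ` ?L \<subseteq> ASM (N div 2)"
      using fold_block_ASM L0 by auto
    show "unfold_block N ` ASM (N div 2) \<subseteq> ?L"
      using L unfold_block_DSASM stair_unfold_block N by blast
    show "\<forall>A\<in>?L. unfold_block N (fold_block N A) = A"
    proof
      fix A assume "A \<in> ?L"
      then have A: "A \<in> DSASM N" and stair: "stair A N = 0" using L0 by auto
      note M = fold_block_ASM[OF A stair]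
      show "unfold_block N (fold_block N A) = A"
      proof (rule DSASM_eqI[OF unfold_block_DSASM[OF M] A])
        fix i j assume ij: "i \<le> j" "j \<le> N"
        consider "N div 2 < i" | "i \<le> N div 2" "j \<le> Suc N div 2" | "i \<le> N div 2" "Suc N div 2 \<le> j"
          by linarith
        then show "corner (unfold_block N (fold_block N A)) i j = corner A i j"
        proof cases
          case 1
          moreover from 1 ij have "Suc N div 2 \<le> j" by presburger
          ultimately show ?thesis
            using corner_if_stair(2)[OF A stair refl refl, of i j] corner_unfold_block[OF M ij] ij
            by simp
        next
          case 2
          then show ?thesis
            using corner_if_stair(1)[OF A stair refl refl, of i j] corner_unfold_block[OF M ij]
            by simp
        next
          case 3
          moreover from 3 ij have "j - Suc N div 2 \<le> N div 2" by presburger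
          ultimately show ?thesis
            using corner_fold_block[OF A stair, of i "j - Suc N div 2"] corner_unfold_block[OF M ij]
            by simp
        qed
      qed
    qed
    show "\<forall>M\<in>ASM (N div 2). fold_block N (unfold_block N M) = M"
    proof
      fix M assume M: "M \<in> ASM (N div 2)"
      then have A: "unfold_block N M \<in> DSASM N" and stair: "stair (unfold_block N M) N = 0"
        using unfold_block_DSASM stair_unfold_block[OF M N, of N] by auto
      show "fold_block N (unfold_block N M) = M"
      proof (rule corner_eqI)
        show "M \<in> carrier_mat (N div 2) (N div 2)"
          using M by (simp add: ASM_def)
        fix i j assume "i \<le> N div 2" "j \<le> N div 2"
        moreover from this have "i \<le> Suc N div 2 + j" "Suc N div 2 + j \<le> N" by presburger+
        ultimately show "corner (fold_block N (unfold_block N M)) i j = corner M i j"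
          using corner_fold_block[OF A stair, of i j]
            corner_unfold_block[OF M, of i "Suc N div 2 + j"] by simp
      qed (simp add: fold_block_def)
    qed
  qed
  then show ?thesis by (rule bij_betw_same_card)
qed

section \<open>The six-vertex configuration of a symmetric matrix\<close>

text \<open>
  Coordinates are those of the triangular graph; \<open>points_up C i j\<close> concerns the edge above (i, j) and
  \<open>points_left C i j\<close> the edge to the right of (i, j).
\<close>

definition points_up :: "arc set \<Rightarrow> nat \<Rightarrow> nat \<Rightarrow> bool" where
  "points_up C i j \<longleftrightarrow> ((i, j), (i - 1, j)) \<in> C"

definition points_left :: "arc set \<Rightarrow> nat \<Rightarrow> nat \<Rightarrow> bool" where
  "points_left C i j \<longleftrightarrow> ((i, Suc j), (i, j)) \<in> C"

lemma T_edges_vertical: "1 \<le> i \<Longrightarrow> i \<le> j \<Longrightarrow> j \<le> n \<Longrightarrow> {(i - 1, j), (i, j)} \<in> T_edges n"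
  unfolding T_edges_def by blast

lemma T_edges_horizontal: "1 \<le> i \<Longrightarrow> i \<le> j \<Longrightarrow> j \<le> n \<Longrightarrow> {(i, j), (i, Suc j)} \<in> T_edges n"
  unfolding T_edges_def by auto

lemma T_edgesE:
  assumes "{u, v} \<in> T_edges n"
  obtains i j where "1 \<le> i" "i \<le> j" "j \<le> n"
    "(u, v) \<in> {((i, j), (i - 1, j)), ((i - 1, j), (i, j)),
      ((i, Suc j), (i, j)), ((i, j), (i, Suc j))}"
  using assms unfolding T_edges_def by (auto simp: doubleton_eq_iff)

lemma orientationsD:
  assumes "C \<in> orientations E"
  shows "(u, v) \<in> C \<Longrightarrow> {u, v} \<in> E"
    and "{u, v} \<in> E \<Longrightarrow> (u, v) \<in> C \<longleftrightarrow> (v, u) \<notin> C"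
  using assms unfolding orientations_def by blast+

lemma points_reverse:
  assumes C: "C \<in> orientations (T_edges n)" and ij: "1 \<le> i" "i \<le> j" "j \<le> n"
  shows "((i - 1, j), (i, j)) \<in> C \<longleftrightarrow> \<not> points_up C i j"
    and "((i, j), (i, Suc j)) \<in> C \<longleftrightarrow> \<not> points_left C i j"
  using orientationsD(2)[OF C T_edges_vertical[OF ij]]
    orientationsD(2)[OF C T_edges_horizontal[OF ij]]
  unfolding points_up_def points_left_def by auto

lemma orientation_eqI:
  assumes C: "C \<in> orientations (T_edges n)" and C': "C' \<in> orientations (T_edges n)"
    and "\<And>i j. 1 \<le> i \<Longrightarrow> i \<le> j \<Longrightarrow> j \<le> n \<Longrightarrow> points_up C i j \<longleftrightarrow> points_up C' i j"
    and "\<And>i j. 1 \<le> i \<Longrightarrow> i \<le> j \<Longrightarrow> j \<le> n \<Longrightarrow> points_left C i j \<longleftrightarrow> points_left C' i j"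
  shows "C = C'"
proof -
  have "(u, v) \<in> C \<longleftrightarrow> (u, v) \<in> C'" if "{u, v} \<in> T_edges n" for u v
    using that
  proof (rule T_edgesE)
    fix i j assume ij: "1 \<le> i" "i \<le> j" "j \<le> n"
      and uv: "(u, v) \<in> {((i, j), (i - 1, j)), ((i - 1, j), (i, j)),
        ((i, Suc j), (i, j)), ((i, j), (i, Suc j))}"
    show ?thesis
      using uv assms(3,4)[OF ij] points_reverse[OF C ij] points_reverse[OF C' ij]
      unfolding points_up_def points_left_def by blast
  qed
  then show ?thesis
    using orientationsD(1)[OF C] orientationsD(1)[OF C'] by (intro equalityI subrelI) blast+
qed

lemma card_filter_eq_sum:
  "finite F \<Longrightarrow> card {u \<in> F. P u} = (\<Sum>u\<in>F. of_bool (P u))"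
  by (simp add: Collect_conj_eq)

lemma
  assumes C: "C \<in> orientations (T_edges n)" and ij: "1 \<le> i" "i < j" "j \<le> n"
  shows card_in_arcs: "card {u. (u, (i, j)) \<in> C} =
      of_bool (\<not> points_up C i j) + of_bool (points_up C (Suc i) j) +
      of_bool (\<not> points_left C i (j - 1)) + of_bool (points_left C i j)" (is "?in = ?s")
    and card_out_arcs: "card {u. ((i, j), u) \<in> C} =
      of_bool (points_up C i j) + of_bool (\<not> points_up C (Suc i) j) +
      of_bool (points_left C i (j - 1)) + of_bool (\<not> points_left C i j)" (is "?out = ?t")
proof -
  let ?F = "{(i - 1, j), (Suc i, j), (i, j - 1), (i, Suc j)}"
  have F: "u \<in> ?F" if "{u, (i, j)} \<in> T_edges n" for u
    using that by (rule T_edgesE) auto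
  have arcs: "((i - 1, j), (i, j)) \<in> C \<longleftrightarrow> \<not> points_up C i j"
    "((Suc i, j), (i, j)) \<in> C \<longleftrightarrow> points_up C (Suc i) j"
    "((i, j - 1), (i, j)) \<in> C \<longleftrightarrow> \<not> points_left C i (j - 1)"
    "((i, Suc j), (i, j)) \<in> C \<longleftrightarrow> points_left C i j"
    "((i, j), (i - 1, j)) \<in> C \<longleftrightarrow> points_up C i j"
    "((i, j), (Suc i, j)) \<in> C \<longleftrightarrow> \<not> points_up C (Suc i) j"
    "((i, j), (i, j - 1)) \<in> C \<longleftrightarrow> points_left C i (j - 1)"
    "((i, j), (i, Suc j)) \<in> C \<longleftrightarrow> \<not> points_left C i j"
    using points_reverse[OF C, of i j] points_reverse[OF C, of "Suc i" j]
      points_reverse[OF C, of i "j - 1"] ij by (simp_all add: points_up_def points_left_def)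
  have sum4: "(\<Sum>u\<in>?F. f u) = f (i - 1, j) + f (Suc i, j) + f (i, j - 1) + f (i, Suc j)"
    for f :: "vertex \<Rightarrow> nat"
    using ij by (simp add: add.assoc)
  have "{u. (u, (i, j)) \<in> C} = {u \<in> ?F. (u, (i, j)) \<in> C}"
    using F orientationsD(1)[OF C] by blast
  then have "?in = card {u \<in> ?F. (u, (i, j)) \<in> C}"
    by (rule arg_cong)
  also have "\<dots> = (\<Sum>u\<in>?F. of_bool ((u, (i, j)) \<in> C))"
    by (rule card_filter_eq_sum) simp
  finally show "?in = ?s"
    unfolding sum4 arcs .
  have "u \<in> ?F" if "((i, j), u) \<in> C" for u
    using F[of u] orientationsD(1)[OF C that] by (simp only: insert_commute[of "(i, j)" u])
  then have "{u. ((i, j), u) \<in> C} = {u \<in> ?F. ((i, j), u) \<in> C}"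
    by blast
  then have "?out = card {u \<in> ?F. ((i, j), u) \<in> C}"
    by (rule arg_cong)
  also have "\<dots> = (\<Sum>u\<in>?F. of_bool (((i, j), u) \<in> C))"
    by (rule card_filter_eq_sum) simp
  finally show "?out = ?t"
    unfolding sum4 arcs .
qed

text \<open>
  Since every bulk vertex has four edges, the condition on the outdegree follows from the one on the
  indegree.
\<close>

lemma sixV_iff:
  "C \<in> sixV n \<longleftrightarrow> C \<in> orientations (T_edges n) \<and>
    (\<forall>i j. 1 \<le> i \<and> i < j \<and> j \<le> n \<longrightarrow>
      of_bool (\<not> points_up C i j) + of_bool (points_up C (Suc i) j) +
      of_bool (\<not> points_left C i (j - 1)) + of_bool (points_left C i j) = (2 :: nat)) \<and>
    (\<forall>j \<in> {1..n}. points_up C 1 j) \<and> (\<forall>i \<in> {1..n}. points_left C i n)"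
proof (cases "C \<in> orientations (T_edges n)")
  case True
  have "of_bool (\<not> a) + of_bool b + of_bool (\<not> c) + of_bool d = (2 :: nat) \<longleftrightarrow>
    of_bool (\<not> a) + of_bool b + of_bool (\<not> c) + of_bool d = (2 :: nat) \<and>
    of_bool a + of_bool (\<not> b) + of_bool c + of_bool (\<not> d) = (2 :: nat)" for a b c d
    by (cases a; cases b; cases c; cases d) simp_all
  then have "card {u. (u, (i, j)) \<in> C} = 2 \<and> card {u. ((i, j), u) \<in> C} = 2 \<longleftrightarrow>
      of_bool (\<not> points_up C i j) + of_bool (points_up C (Suc i) j) +
      of_bool (\<not> points_left C i (j - 1)) + of_bool (points_left C i j) = (2 :: nat)"
    if "1 \<le> i \<and> i < j \<and> j \<le> n" for i j
    using that card_in_arcs[OF True, of i j] card_out_arcs[OF True, of i j] by (simp only:)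
  then show ?thesis
    using True unfolding sixV_def by (simp add: points_up_def points_left_def)
qed (simp add: sixV_def)

lemma vertex_entry_bulk:
  assumes C: "C \<in> orientations (T_edges n)" and ij: "1 \<le> i" "i < j" "j \<le> n"
  shows "vertex_entry C i j =
    (if points_up C i j \<and> \<not> points_up C (Suc i) j \<and> \<not> points_left C i (j - 1) \<and> points_left C i j
     then 1
     else if \<not> points_up C i j \<and> points_up C (Suc i) j \<and> points_left C i (j - 1) \<and> \<not> points_left C i j
     then -1 else 0)"
  using points_reverse[OF C, of i j] points_reverse[OF C, of "Suc i" j]
    points_reverse[OF C, of i "j - 1"] ij
  unfolding vertex_entry_def by (simp add: points_up_def points_left_def)

lemma vertex_entry_diag:
  assumes C: "C \<in> orientations (T_edges n)" and i: "1 \<le> i" "i \<le> n"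
  shows "vertex_entry C i i =
    (if points_up C i i \<and> points_left C i i then 1
     else if \<not> points_up C i i \<and> \<not> points_left C i i then -1 else 0)"
  using points_reverse[OF C, of i i] i
  unfolding vertex_entry_def by (simp add: points_up_def points_left_def)

text \<open>
  Of the six vertex states, the four with entry 0 carry both orientations straight through the vertex
  and the two others reverse both.
\<close>

lemma
  assumes C: "C \<in> sixV n" and ij: "1 \<le> i" "i < j" "j \<le> n"
  shows points_up_Suc: "points_up C (Suc i) j \<longleftrightarrow> points_up C i j \<noteq> (vertex_entry C i j \<noteq> 0)"
    and points_left_Suc: "points_left C i j \<longleftrightarrow> points_left C i (j - 1) \<noteq> (vertex_entry C i j \<noteq> 0)"
proof -
  have C': "C \<in> orientations (T_edges n)"
    and two: "of_bool (\<not> points_up C i j) + of_bool (points_up C (Suc i) j) +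
      of_bool (\<not> points_left C i (j - 1)) + of_bool (points_left C i j) = (2 :: nat)"
    using C ij unfolding sixV_iff by blast+
  show "points_up C (Suc i) j \<longleftrightarrow> points_up C i j \<noteq> (vertex_entry C i j \<noteq> 0)"
    "points_left C i j \<longleftrightarrow> points_left C i (j - 1) \<noteq> (vertex_entry C i j \<noteq> 0)"
    unfolding vertex_entry_bulk[OF C' ij] using two
    by (cases "points_up C i j"; cases "points_up C (Suc i) j";
        cases "points_left C i (j - 1)"; cases "points_left C i j"; simp)+
qed

text \<open>
  The matrix determines the vertical edges from the top downwards, then the horizontal edges from the
  diagonal to the right.
\<close>

lemma inj_on_mat_of_conf: "inj_on (mat_of_conf n) (sixV n)"
proof
  fix C C' assume C: "C \<in> sixV n" and C': "C' \<in> sixV n" and eq: "mat_of_conf n C = mat_of_conf n C'"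
  note o = C[unfolded sixV_iff, THEN conjunct1] C'[unfolded sixV_iff, THEN conjunct1]
  have entry: "vertex_entry C i j = vertex_entry C' i j" if "1 \<le> i" "i \<le> j" "j \<le> n" for i j
    using arg_cong[OF eq, of "\<lambda>A. A $$ (i - 1, j - 1)"] that by (simp add: mat_of_conf_def)
  have up: "points_up C i j \<longleftrightarrow> points_up C' i j" if "1 \<le> i" "i \<le> j" "j \<le> n" for i j
    using that
  proof (induction i rule: nat_induct_at_least)
    case base
    then show ?case using C C' unfolding sixV_iff by auto
  next
    case (Suc i)
    then show ?case
      using points_up_Suc[OF C, of i j] points_up_Suc[OF C', of i j] entry[of i j] by simp
  qed
  have left: "points_left C i j \<longleftrightarrow> points_left C' i j" if "i \<le> j" "1 \<le> i" "j \<le> n" for i j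
    using that
  proof (induction j rule: dec_induct)
    case base
    then have i: "1 \<le> i" "i \<le> n" by auto
    then have "points_up C i i \<longleftrightarrow> points_up C' i i" "vertex_entry C i i = vertex_entry C' i i"
      using up entry by auto
    then show ?case
      unfolding vertex_entry_diag[OF o(1) i] vertex_entry_diag[OF o(2) i] by (auto split: if_splits)
  next
    case (step j)
    then show ?case
      using points_left_Suc[OF C, of i "Suc j"] points_left_Suc[OF C', of i "Suc j"]
        entry[of i "Suc j"] by simp
  qed
  show "C = C'"
    using orientation_eqI[OF o] up left by blast
qed

definition orient :: "nat \<Rightarrow> (nat \<Rightarrow> nat \<Rightarrow> bool) \<Rightarrow> (nat \<Rightarrow> nat \<Rightarrow> bool) \<Rightarrow> arc set" where
  "orient n U L = {(u, v). \<exists>i j. 1 \<le> i \<and> i \<le> j \<and> j \<le> n \<and>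
    (u = (i, j) \<and> v = (i - 1, j) \<and> U i j \<or> u = (i - 1, j) \<and> v = (i, j) \<and> \<not> U i j \<or>
     u = (i, Suc j) \<and> v = (i, j) \<and> L i j \<or> u = (i, j) \<and> v = (i, Suc j) \<and> \<not> L i j)}"

lemma orient_arcs:
  assumes "1 \<le> i" "i \<le> j" "j \<le> n"
  shows "((i, j), (i - 1, j)) \<in> orient n U L \<longleftrightarrow> U i j"
    and "((i - 1, j), (i, j)) \<in> orient n U L \<longleftrightarrow> \<not> U i j"
    and "((i, Suc j), (i, j)) \<in> orient n U L \<longleftrightarrow> L i j"
    and "((i, j), (i, Suc j)) \<in> orient n U L \<longleftrightarrow> \<not> L i j"
proof -
  show "((i, j), (i - 1, j)) \<in> orient n U L \<longleftrightarrow> U i j"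
    using assms unfolding orient_def by auto
  show "((i - 1, j), (i, j)) \<in> orient n U L \<longleftrightarrow> \<not> U i j"
    using assms unfolding orient_def by auto
  show "((i, Suc j), (i, j)) \<in> orient n U L \<longleftrightarrow> L i j"
    using assms unfolding orient_def by auto
  show "((i, j), (i, Suc j)) \<in> orient n U L \<longleftrightarrow> \<not> L i j"
    using assms unfolding orient_def by auto
qed

lemma orient_orientation: "orient n U L \<in> orientations (T_edges n)"
  unfolding orientations_def
proof (intro CollectI conjI allI impI ballI)
  fix e assume "e \<in> orient n U L"
  then obtain u v i j where e: "e = (u, v)" and ij: "1 \<le> i" "i \<le> j" "j \<le> n"
    and "{u, v} = {(i - 1, j), (i, j)} \<or> {u, v} = {(i, j), (i, Suc j)}"
    unfolding orient_def by blast
  then show "case e of (u, v) \<Rightarrow> {u, v} \<in> T_edges n"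
    using T_edges_vertical[OF ij] T_edges_horizontal[OF ij] by auto
next
  fix u v assume "{u, v} \<in> T_edges n"
  then show "((u, v) \<in> orient n U L) \<noteq> ((v, u) \<in> orient n U L)"
  proof (rule T_edgesE)
    fix i j assume ij: "1 \<le> i" "i \<le> j" "j \<le> n"
      and "(u, v) \<in> {((i, j), (i - 1, j)), ((i - 1, j), (i, j)),
        ((i, Suc j), (i, j)), ((i, j), (i, Suc j))}"
    then show ?thesis
      using orient_arcs[OF ij, of U L] by blast
  qed
qed

text \<open>
  A vertical edge points up iff the corner sums do not increase along the step from (i - 1, j - 1) to
  (i - 1, j); a horizontal edge points left iff they increase along the step from (i - 1, j) to (i, j).
\<close>

definition conf_of_corners :: "nat \<Rightarrow> int mat \<Rightarrow> arc set" where
  "conf_of_corners n A = orient n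
    (\<lambda>i j. corner A (i - 1) j = corner A (i - 1) (j - 1))
    (\<lambda>i j. corner A i j \<noteq> corner A (i - 1) j)"

lemma points_conf_of_corners:
  assumes "1 \<le> i" "i \<le> j" "j \<le> n"
  shows "points_up (conf_of_corners n A) i j \<longleftrightarrow> corner A (i - 1) j = corner A (i - 1) (j - 1)"
    and "points_left (conf_of_corners n A) i j \<longleftrightarrow> corner A i j \<noteq> corner A (i - 1) j"
  using orient_arcs[OF assms] unfolding conf_of_corners_def points_up_def points_left_def by auto

text \<open>
  The four edges at a bulk vertex are the four sides of a unit square of corner sums; the two ways
  around the square have the same total increase, which amounts to indegree 2.
\<close>

lemma conf_of_corners_sixV:
  assumes A: "A \<in> DSASM n"
  shows "conf_of_corners n A \<in> sixV n"
  unfolding sixV_iff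
proof (intro conjI allI impI ballI)
  note H = corner_sumsD[OF DSASM_D(2)[OF A]]
  show "conf_of_corners n A \<in> orientations (T_edges n)"
    unfolding conf_of_corners_def by (rule orient_orientation)
  show "points_up (conf_of_corners n A) 1 j" if "j \<in> {1..n}" for j
    using points_conf_of_corners(1)[of 1 j n A] that by simp
  show "points_left (conf_of_corners n A) i n" if "i \<in> {1..n}" for i
  proof -
    have "corner A i n = int i" "corner A (i - 1) n = int (i - 1)" "i \<noteq> i - 1"
      using H(3) that by auto
    then show ?thesis
      using points_conf_of_corners(2)[of i n n A] that by simp
  qed
  fix i j assume ij: "1 \<le> i \<and> i < j \<and> j \<le> n"
  have square: "of_bool (b \<noteq> a) + of_bool (d = c) + of_bool (c = a) + of_bool (d \<noteq> b) = (2 :: nat)"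
    if "b - a \<in> {0, 1}" "d - c \<in> {0, 1}" "c - a \<in> {0, 1}" "d - b \<in> {0, 1}" for a b c d :: int
    using that by auto
  have "of_bool (corner A (i - 1) j \<noteq> corner A (i - 1) (j - 1)) +
      of_bool (corner A i j = corner A i (j - 1)) +
      of_bool (corner A i (j - 1) = corner A (i - 1) (j - 1)) +
      of_bool (corner A i j \<noteq> corner A (i - 1) j) = (2 :: nat)"
    using ij H(5)[of "i - 1" j] H(5)[of "i - 1" "j - 1"] H(6)[of i "j - 1"] H(6)[of "i - 1" "j - 1"]
    by (intro square) auto
  moreover have
    "points_up (conf_of_corners n A) i j \<longleftrightarrow> corner A (i - 1) j = corner A (i - 1) (j - 1)"
    "points_left (conf_of_corners n A) i j \<longleftrightarrow> corner A i j \<noteq> corner A (i - 1) j"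
    "points_left (conf_of_corners n A) i (j - 1) \<longleftrightarrow> corner A i (j - 1) \<noteq> corner A (i - 1) (j - 1)"
    by (rule points_conf_of_corners; use ij in linarith)+
  moreover have
    "points_up (conf_of_corners n A) (Suc i) j \<longleftrightarrow> corner A i j = corner A i (j - 1)"
    using points_conf_of_corners(1)[of "Suc i" j n A] ij by (simp only: diff_Suc_1) simp
  ultimately show "of_bool (\<not> points_up (conf_of_corners n A) i j) +
      of_bool (points_up (conf_of_corners n A) (Suc i) j) +
      of_bool (\<not> points_left (conf_of_corners n A) i (j - 1)) +
      of_bool (points_left (conf_of_corners n A) i j) = (2 :: nat)"
    by (simp only: not_not)
qed

lemma mat_of_conf_of_corners:
  assumes A: "A \<in> DSASM n"
  shows "mat_of_conf n (conf_of_corners n A) = A"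
proof -
  let ?C = "conf_of_corners n A"
  note H = corner_sumsD[OF DSASM_D(2)[OF A]]
  have C: "?C \<in> orientations (T_edges n)"
    unfolding conf_of_corners_def by (rule orient_orientation)
  have entry: "vertex_entry ?C (Suc k) (Suc l) = A $$ (k, l)" if "k \<le> l" "l < n" for k l
  proof (cases "k = l")
    case True
    have "A $$ (l, l) = (corner A (Suc l) (Suc l) - corner A l (Suc l)) - (corner A l (Suc l) - corner A l l)"
      using entry_corner[of A l l] DSASM_D(3)[OF A, of "Suc l" l] that by simp
    then show ?thesis
      using True vertex_entry_diag[OF C, of "Suc l"] that H(5)[of l "Suc l"] H(6)[of l l]
      by (auto simp: points_conf_of_corners)
  next
    case False
    have square: "(if b = a \<and> d \<noteq> c \<and> c = a \<and> d \<noteq> b then 1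
        else if b \<noteq> a \<and> d = c \<and> c \<noteq> a \<and> d = b then -1 else 0) = d - b - c + a"
      if "b - a \<in> {0, 1}" "d - c \<in> {0, 1}" "c - a \<in> {0, 1}" "d - b \<in> {0, 1}" for a b c d :: int
      using that by auto
    have "A $$ (k, l) = (if corner A k (Suc l) = corner A k l \<and> corner A (Suc k) (Suc l) \<noteq> corner A (Suc k) l \<and>
          corner A (Suc k) l = corner A k l \<and> corner A (Suc k) (Suc l) \<noteq> corner A k (Suc l) then 1
        else if corner A k (Suc l) \<noteq> corner A k l \<and> corner A (Suc k) (Suc l) = corner A (Suc k) l \<and>
          corner A (Suc k) l \<noteq> corner A k l \<and> corner A (Suc k) (Suc l) = corner A k (Suc l) then -1 else 0)"
      unfolding entry_corner[of A k l]
      using H(5)[of k "Suc l"] H(5)[of k l] H(6)[of "Suc k" l] H(6)[of k l] that False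
      by (intro square[symmetric]) auto
    then show ?thesis
      using vertex_entry_bulk[OF C, of "Suc k" "Suc l"] False that
      by (simp add: points_conf_of_corners)
  qed
  show ?thesis
  proof (rule eq_matI)
    fix i j assume "i < dim_row A" "j < dim_col A"
    then have ij: "i < n" "j < n" using DSASM_D(1)[OF A] by auto
    have "transpose_mat A $$ (i, j) = A $$ (j, i)"
      using ij DSASM_D(1)[OF A] by simp
    then have "A $$ (min i j, max i j) = A $$ (i, j)"
      using A unfolding DSASM_def by (simp add: min_def max_def)
    then show "mat_of_conf n ?C $$ (i, j) = A $$ (i, j)"
      using entry[of "min i j" "max i j"] ij by (simp add: mat_of_conf_def)
  qed (use DSASM_D(1)[OF A] in \<open>auto simp: mat_of_conf_def\<close>)
qed

lemma conf_of_mat_mat_of_conf: "C \<in> sixV n \<Longrightarrow> conf_of_mat n (mat_of_conf n C) = C"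
  unfolding conf_of_mat_def using inj_on_mat_of_conf by (rule the_inv_into_f_f)

lemma conf_of_mat_DSASM: "A \<in> DSASM n \<Longrightarrow> conf_of_mat n A = conf_of_corners n A"
  using conf_of_mat_mat_of_conf[OF conf_of_corners_sixV] mat_of_conf_of_corners by metis

section \<open>Fixed points of the involutions\<close>

lemma swap_arc_swap_arc: "k \<ge> 2 \<Longrightarrow> swap_arc k (swap_arc k e) = e"
  unfolding swap_arc_def Let_def by auto

lemma mem_swap_conf: "k \<ge> 2 \<Longrightarrow> e \<in> swap_conf k C \<longleftrightarrow> swap_arc k e \<in> C"
  unfolding swap_conf_def by (metis image_iff swap_arc_swap_arc)

lemma swap_arc_moves:
  assumes "swap_arc k e \<noteq> e"
  shows "e \<in> {((k - 1, k - 1), (k - 1, k)), ((k, k), (k - 1, k)),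
    ((k - 1, k), (k - 1, k - 1)), ((k - 1, k), (k, k))}"
  using assms unfolding swap_arc_def Let_def by (auto split: if_splits)

lemma swap_arc_disjoint:
  assumes "swap_arc k e \<noteq> e" "j \<noteq> k" "j \<ge> 2" "k \<ge> 2"
  shows "swap_arc j e = e"
proof (rule ccontr)
  assume "swap_arc j e \<noteq> e"
  moreover obtain j' k' where "j = Suc j'" "k = Suc k'"
    using assms(3,4) by (metis Suc_le_D numeral_2_eq_2)
  ultimately show False
    using swap_arc_moves[OF assms(1)] swap_arc_moves[of j e] assms(2) by auto
qed

lemma swap_arc_arcs:
  assumes "k \<ge> 2"
  shows "swap_arc k ((k - 1, k - 1), (k - 1, k)) = ((k, k), (k - 1, k))"
    "swap_arc k ((k, k), (k - 1, k)) = ((k - 1, k - 1), (k - 1, k))"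
    "swap_arc k ((k - 1, k), (k - 1, k - 1)) = ((k - 1, k), (k, k))"
    "swap_arc k ((k - 1, k), (k, k)) = ((k - 1, k), (k - 1, k - 1))"
  using assms unfolding swap_arc_def Let_def by auto

lemma super_edges:
  assumes "k \<in> {2..n}"
  shows "{(k - 1, k - 1), (k - 1, k)} \<in> T_edges n" "{(k, k), (k - 1, k)} \<in> T_edges n"
  using T_edges_horizontal[of "k - 1" "k - 1" n] T_edges_vertical[of k k n] assms
  by (auto simp: insert_commute)

lemma swap_conf_orientation:
  assumes C: "C \<in> orientations (T_edges n)" and k: "k \<in> {2..n}"
  shows "swap_conf k C \<in> orientations (T_edges n)"
proof -
  have edge: "{fst (swap_arc k (u, v)), snd (swap_arc k (u, v))} \<in> T_edges n \<longleftrightarrow> {u, v} \<in> T_edges n"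
    for u v
  proof (cases "swap_arc k (u, v) = (u, v)")
    case False
    then show ?thesis
      using swap_arc_moves[of k "(u, v)"] super_edges[OF k] swap_arc_arcs[of k] k
      by (auto simp: insert_commute)
  qed simp
  have rev: "swap_arc k (v, u) = prod.swap (swap_arc k (u, v))" for u v
  proof (cases "swap_arc k (u, v) = (u, v)")
    case True
    have "swap_arc k (v, u) = (v, u)"
    proof (rule ccontr)
      assume "swap_arc k (v, u) \<noteq> (v, u)"
      from swap_arc_moves[OF this] show False
        using True swap_arc_arcs[of k] k by auto
    qed
    then show ?thesis using True by simp
  next
    case False
    then show ?thesis
      using swap_arc_moves[of k "(u, v)"] swap_arc_arcs[of k] k by auto
  qed
  have k2: "k \<ge> 2" using k by simp
  have oriented: "{fst e, snd e} \<in> T_edges n \<Longrightarrow> (e \<in> C) \<noteq> (prod.swap e \<in> C)"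
    "e \<in> C \<Longrightarrow> {fst e, snd e} \<in> T_edges n" for e
    using orientationsD[OF C, of "fst e" "snd e"] by (auto simp: prod.swap_def)
  show ?thesis
    unfolding orientations_def
  proof (intro CollectI conjI allI impI ballI)
    fix e assume "e \<in> swap_conf k C"
    then show "case e of (u, v) \<Rightarrow> {u, v} \<in> T_edges n"
      using oriented(2)[of "swap_arc k e"] edge[of "fst e" "snd e"] mem_swap_conf[OF k2, of e]
      by (auto simp: case_prod_unfold)
  next
    fix u v assume "{u, v} \<in> T_edges n"
    then show "((u, v) \<in> swap_conf k C) \<noteq> ((v, u) \<in> swap_conf k C)"
      using oriented(1)[of "swap_arc k (u, v)"] edge[of u v] rev[where u = u and v = v]
        mem_swap_conf[OF k2] by simp
  qed
qed

text \<open>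
  At the bulk vertex (k - 1, k) the swap permutes the neighbours, by f below, and at every other bulk
  vertex it changes nothing, so no degree changes.
\<close>

lemma swap_conf_sixV:
  assumes C: "C \<in> sixV n" and k: "k \<in> {2..n}"
  shows "swap_conf k C \<in> sixV n"
proof -
  have k2: "k \<ge> 2" using k by simp
  define f where "f = (\<lambda>u :: vertex. if u = (k - 1, k - 1) then (k, k)
    else if u = (k, k) then (k - 1, k - 1) else u)"
  have f: "f (f u) = u" for u by (auto simp: f_def)
  have card_f: "card {u. f u \<in> X} = card X" for X
  proof (rule bij_betw_same_card)
    show "bij_betw f {u. f u \<in> X} X"
      by (rule bij_betw_byWitness[where f' = f]) (auto simp: f)
  qed
  have bulk: "swap_arc k (u, (i, j)) = ((if (i, j) = (k - 1, k) then f u else u), (i, j))"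
    "swap_arc k ((i, j), u) = ((i, j), (if (i, j) = (k - 1, k) then f u else u))"
    if "i < j" for i j u
    using that k unfolding swap_arc_def f_def Let_def by auto
  have "card {u. (u, (i, j)) \<in> swap_conf k C} = card {u. (u, (i, j)) \<in> C} \<and>
      card {u. ((i, j), u) \<in> swap_conf k C} = card {u. ((i, j), u) \<in> C}" if "i < j" for i j
    using card_f[of "{u. (u, (i, j)) \<in> C}"] card_f[of "{u. ((i, j), u) \<in> C}"]
    unfolding mem_swap_conf[OF k2] bulk[OF that]
    by (cases "(i, j) = (k - 1, k)") (simp_all only: if_True if_False mem_Collect_eq simp_thms)
  moreover have "swap_arc k ((1, j), (0, j)) = ((1, j), (0, j))" for j
    using swap_arc_moves[of k "((1, j), (0, j))"] k2 by force
  moreover have "swap_arc k ((i, n + 1), (i, n)) = ((i, n + 1), (i, n))" for i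
    using swap_arc_moves[of k "((i, n + 1), (i, n))"] k by force
  ultimately show ?thesis
    using C swap_conf_orientation[OF _ k, of C] unfolding sixV_def by (simp add: mem_swap_conf[OF k2])
qed

lemma fold_swap_conf_sixV:
  "C \<in> sixV n \<Longrightarrow> set ks \<subseteq> {2..n} \<Longrightarrow> fold swap_conf ks C \<in> sixV n"
  by (induction ks arbitrary: C) (simp_all add: swap_conf_sixV)

lemma mem_fold_swap_conf_fixed:
  "\<forall>k \<in> set ks. k \<ge> 2 \<and> swap_arc k e = e \<Longrightarrow> e \<in> fold swap_conf ks C \<longleftrightarrow> e \<in> C"
  by (induction ks arbitrary: C) (simp_all add: mem_swap_conf)

text \<open>
  Swaps at different superdiagonal vertices move disjoint sets of arcs, so in a sequence of swaps every
  arc is moved at most once.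
\<close>

lemma mem_fold_swap_conf_moved:
  assumes "distinct ks" "\<forall>j \<in> set ks. j \<ge> 2" "k \<in> set ks" "swap_arc k e \<noteq> e"
  shows "e \<in> fold swap_conf ks C \<longleftrightarrow> swap_arc k e \<in> C"
  using assms
proof (induction ks arbitrary: C)
  case (Cons j ks)
  have k: "k \<ge> 2" using Cons.prems by auto
  show ?case
  proof (cases "j = k")
    case True
    have "\<forall>i \<in> set ks. i \<ge> 2 \<and> swap_arc i e = e"
      using Cons.prems True k by (auto intro!: swap_arc_disjoint[OF Cons.prems(4)])
    then show ?thesis
      using True k by (simp add: mem_fold_swap_conf_fixed mem_swap_conf)
  next
    case False
    then have "e \<in> fold swap_conf ks (swap_conf j C) \<longleftrightarrow> swap_arc k e \<in> swap_conf j C"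
      using Cons by simp
    moreover have "swap_arc k (swap_arc k e) \<noteq> swap_arc k e"
      using Cons.prems(4) swap_arc_swap_arc[OF k, of e] by metis
    then have "swap_arc j (swap_arc k e) = swap_arc k e"
      using swap_arc_disjoint False Cons.prems k by auto
    ultimately show ?thesis
      using Cons.prems by (simp add: mem_swap_conf)
  qed
qed simp

lemma mem_star_conf_fixed:
  "\<forall>k \<in> {2..n}. swap_arc k e = e \<Longrightarrow> e \<in> star_conf n C \<longleftrightarrow> e \<in> C"
  unfolding star_conf_def by (rule mem_fold_swap_conf_fixed) auto

lemma mem_star_conf_moved:
  "k \<in> {2..n} \<Longrightarrow> swap_arc k e \<noteq> e \<Longrightarrow> e \<in> star_conf n C \<longleftrightarrow> swap_arc k e \<in> C"
  unfolding star_conf_def by (rule mem_fold_swap_conf_moved) auto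

lemma star_conf_sixV: "C \<in> sixV n \<Longrightarrow> star_conf n C \<in> sixV n"
  unfolding star_conf_def by (intro fold_swap_conf_sixV) auto

lemma swap_conf_eq_iff:
  assumes C: "C \<in> orientations (T_edges n)" and k: "k \<in> {2..n}"
  shows "swap_conf k C = C \<longleftrightarrow> \<not> mixed C k"
proof
  have k2: "k \<ge> 2" using k by simp
  assume "swap_conf k C = C"
  then show "\<not> mixed C k"
    using mem_swap_conf[OF k2, of "((k - 1, k - 1), (k - 1, k))" C] swap_arc_arcs[OF k2]
    unfolding mixed_def by simp
next
  have k2: "k \<ge> 2" using k by simp
  assume "\<not> mixed C k"
  then have into: "((k - 1, k - 1), (k - 1, k)) \<in> C \<longleftrightarrow> ((k, k), (k - 1, k)) \<in> C"
    unfolding mixed_def by blast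
  have out: "((k - 1, k), (k - 1, k - 1)) \<in> C \<longleftrightarrow> ((k - 1, k), (k, k)) \<in> C"
    using into orientationsD(2)[OF C] super_edges[OF k] by blast
  have "swap_arc k e \<in> C \<longleftrightarrow> e \<in> C" for e
  proof (cases "swap_arc k e = e")
    case False
    from swap_arc_moves[OF this] show ?thesis
      using into out swap_arc_arcs[OF k2] by auto
  qed simp
  then show "swap_conf k C = C"
    using mem_swap_conf[OF k2] by blast
qed

lemma star_conf_eq_iff:
  assumes C: "C \<in> orientations (T_edges n)"
  shows "star_conf n C = C \<longleftrightarrow> (\<forall>k \<in> {2..n}. \<not> mixed C k)"
proof -
  have mem: "e \<in> swap_conf k C \<longleftrightarrow> swap_arc k e \<in> C" if "k \<in> {2..n}" for k e
    using that by (simp add: mem_swap_conf)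
  have "star_conf n C = C \<longleftrightarrow> (\<forall>k \<in> {2..n}. swap_conf k C = C)"
  proof
    assume star: "star_conf n C = C"
    show "\<forall>k \<in> {2..n}. swap_conf k C = C"
    proof
      fix k assume "k \<in> {2..n}"
      then have "e \<in> swap_conf k C \<longleftrightarrow> e \<in> C" for e
        using mem mem_star_conf_moved[of k n e C] star by (cases "swap_arc k e = e") auto
      then show "swap_conf k C = C" by blast
    qed
  next
    assume swap: "\<forall>k \<in> {2..n}. swap_conf k C = C"
    show "star_conf n C = C"
    proof (rule Set.set_eqI)
      fix e
      show "e \<in> star_conf n C \<longleftrightarrow> e \<in> C"
      proof (cases "\<forall>k \<in> {2..n}. swap_arc k e = e")
        case False
        then obtain k where "k \<in> {2..n}" "swap_arc k e \<noteq> e" by blast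
        then show ?thesis using mem_star_conf_moved[of k n e C] mem swap by blast
      qed (rule mem_star_conf_fixed)
    qed
  qed
  then show ?thesis using swap_conf_eq_iff[OF C] by blast
qed

text \<open>
  At the vertex with index l the two swaps cancel; at every other superdiagonal vertex there is one.
\<close>

lemma star_conf_swap_conf_eq_iff:
  assumes C: "C \<in> orientations (T_edges n)" and l: "l \<in> {2..n}"
  shows "star_conf n (swap_conf l C) = C \<longleftrightarrow> (\<forall>k \<in> {2..n} - {l}. \<not> mixed C k)"
proof -
  have mem: "e \<in> swap_conf k X \<longleftrightarrow> swap_arc k e \<in> X" if "k \<in> {2..n}" for k e X
    using that by (simp add: mem_swap_conf)
  have fixed: "e \<in> star_conf n (swap_conf l C) \<longleftrightarrow> e \<in> C" if "\<forall>k \<in> {2..n} - {l}. swap_arc k e = e" for e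
  proof (cases "swap_arc l e = e")
    case True
    then have "\<forall>k \<in> {2..n}. swap_arc k e = e"
      using that by blast
    then show ?thesis
      using mem_star_conf_fixed[of n e "swap_conf l C"] mem[OF l, of e C] True by simp
  next
    case False
    then show ?thesis
      using mem_star_conf_moved[OF l, of e "swap_conf l C"] mem[OF l, of "swap_arc l e" C]
        swap_arc_swap_arc[of l e] l by simp
  qed
  have moved: "e \<in> star_conf n (swap_conf l C) \<longleftrightarrow> e \<in> swap_conf k C"
    if k: "k \<in> {2..n} - {l}" and e: "swap_arc k e \<noteq> e" for k e
  proof -
    have "swap_arc k (swap_arc k e) \<noteq> swap_arc k e"
      using e swap_arc_swap_arc[of k e] k by auto
    then have "swap_arc l (swap_arc k e) = swap_arc k e"
      using swap_arc_disjoint[of k "swap_arc k e" l] k l by auto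
    then show ?thesis
      using mem_star_conf_moved[of k n e "swap_conf l C"] mem[OF l, of "swap_arc k e" C]
        mem[of k e C] k e by auto
  qed
  have "star_conf n (swap_conf l C) = C \<longleftrightarrow> (\<forall>k \<in> {2..n} - {l}. swap_conf k C = C)"
  proof
    assume star: "star_conf n (swap_conf l C) = C"
    show "\<forall>k \<in> {2..n} - {l}. swap_conf k C = C"
    proof
      fix k assume k: "k \<in> {2..n} - {l}"
      have "e \<in> swap_conf k C \<longleftrightarrow> e \<in> C" for e
        using k mem[of k e C] moved[OF k, of e] star by (cases "swap_arc k e = e") auto
      then show "swap_conf k C = C" by blast
    qed
  next
    assume swap: "\<forall>k \<in> {2..n} - {l}. swap_conf k C = C"
    show "star_conf n (swap_conf l C) = C"
    proof (rule Set.set_eqI)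
      fix e
      show "e \<in> star_conf n (swap_conf l C) \<longleftrightarrow> e \<in> C"
      proof (cases "\<forall>k \<in> {2..n} - {l}. swap_arc k e = e")
        case False
        then obtain k where "k \<in> {2..n} - {l}" "swap_arc k e \<noteq> e" by blast
        then show ?thesis using moved swap by blast
      qed (rule fixed)
    qed
  qed
  then show ?thesis using swap_conf_eq_iff[OF C] by blast
qed

lemma mixed_conf_of_corners:
  assumes A: "A \<in> DSASM n"
  shows "{k \<in> {2..n}. mixed (conf_of_corners n A) k} = (\<lambda>j. j + 2) ` unpaired n A"
proof -
  let ?C = "conf_of_corners n A"
  note H = corner_sumsD[OF DSASM_D(2)[OF A]]
  have C: "?C \<in> orientations (T_edges n)"
    unfolding conf_of_corners_def by (rule orient_orientation)
  have mixed: "mixed ?C (j + 2) \<longleftrightarrow> j \<in> unpaired n A" if "j + 2 \<le> n" for j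
  proof -
    let ?x = "corner A (Suc j) (Suc j) - corner A j (Suc j)"
    let ?y = "corner A (Suc j) (Suc (Suc j)) - corner A (Suc j) (Suc j)"
    have "((Suc j, Suc j), (Suc j, Suc (Suc j))) \<in> ?C \<longleftrightarrow> ?x = 0"
      using points_reverse(2)[OF C, of "Suc j" "Suc j"] that
        points_conf_of_corners(2)[of "Suc j" "Suc j" n A] by simp
    moreover have "((Suc (Suc j), Suc (Suc j)), (Suc j, Suc (Suc j))) \<in> ?C \<longleftrightarrow> ?y = 0"
      using points_conf_of_corners(1)[of "Suc (Suc j)" "Suc (Suc j)" n A] that
      by (simp add: points_up_def)
    ultimately have "mixed ?C (j + 2) \<longleftrightarrow> (?x = 0) \<noteq> (?y = 0)"
      unfolding mixed_def by simp
    also have "\<dots> \<longleftrightarrow> odd (?x + ?y)"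
    proof -
      have "(x = 0) \<noteq> (y = 0) \<longleftrightarrow> odd (x + y)" if "x \<in> {0, 1}" "y \<in> {0, 1}" for x y :: int
        using that by auto
      moreover have "?x \<in> {0, 1}" "?y \<in> {0, 1}"
        using H(5)[of j "Suc j"] H(6)[of "Suc j" "Suc j"] that by simp_all
      ultimately show ?thesis by blast
    qed
    also have "?x + ?y = corner A (Suc j) (Suc (Suc j)) - corner A j (Suc j)" by simp
    also have "odd \<dots> \<longleftrightarrow> j \<in> unpaired n A"
      using that unfolding unpaired_def by simp
    finally show ?thesis .
  qed
  show ?thesis
  proof (intro equalityI subsetI)
    fix k assume k: "k \<in> {k \<in> {2..n}. mixed ?C k}"
    then obtain j where "k = j + 2"
      by (metis (no_types, lifting) atLeastAtMost_iff le_add_diff_inverse2 mem_Collect_eq)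
    then show "k \<in> (\<lambda>j. j + 2) ` unpaired n A"
      using k mixed[of j] by auto
  next
    fix k assume "k \<in> (\<lambda>j. j + 2) ` unpaired n A"
    then obtain j where j: "k = j + 2" "j \<in> unpaired n A" by blast
    then have "j + 2 \<le> n" by (auto simp: unpaired_def)
    then show "k \<in> {k \<in> {2..n}. mixed ?C k}"
      using j mixed[of j] by simp
  qed
qed

text \<open>
  An involution fixes A iff every swap that it performs is at a vertex that is not mixed. The first
  mixed vertex, at which \<^const>\<open>dagger\<close> swaps, is still mixed afterwards, so \<^const>\<open>star\<close> undoes that
  swap, and \<^const>\<open>star_dagger\<close> in effect swaps everywhere else.
\<close>

lemma
  assumes A: "A \<in> DSASM n"
  shows star_fixed_iff: "star n A = A \<longleftrightarrow> unpaired n A = {}"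
    and dagger_fixed_iff: "dagger n A = A \<longleftrightarrow> unpaired n A = {}"
    and star_dagger_fixed_iff: "star_dagger n A = A \<longleftrightarrow> card (unpaired n A) \<le> 1"
proof -
  define C where "C = conf_of_corners n A"
  have C: "C \<in> sixV n" and A_eq: "mat_of_conf n C = A"
    unfolding C_def using conf_of_corners_sixV[OF A] mat_of_conf_of_corners[OF A] by auto
  have o: "C \<in> orientations (T_edges n)" using C unfolding sixV_iff by blast
  have conf: "conf_of_mat n A = C" using conf_of_mat_DSASM[OF A] by (simp add: C_def)
  have eq_A: "mat_of_conf n X = A \<longleftrightarrow> X = C" if "X \<in> sixV n" for X
    using inj_on_eq_iff[OF inj_on_mat_of_conf that C] A_eq by simp
  define M where "M = {k \<in> {2..n}. mixed C k}"
  have M: "M = (\<lambda>j. j + 2) ` unpaired n A"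
    unfolding M_def C_def by (rule mixed_conf_of_corners[OF A])
  then have card_M: "card M = card (unpaired n A)"
    by (simp add: card_image inj_on_def)
  have "star n A = A \<longleftrightarrow> star_conf n C = C"
    unfolding star_def conf using eq_A star_conf_sixV[OF C] by blast
  also have "\<dots> \<longleftrightarrow> M = {}"
    unfolding star_conf_eq_iff[OF o] M_def by blast
  finally have star: "star n A = A \<longleftrightarrow> M = {}" .
  then show "star n A = A \<longleftrightarrow> unpaired n A = {}"
    unfolding M by simp
  show "dagger n A = A \<longleftrightarrow> unpaired n A = {}"
    and "star_dagger n A = A \<longleftrightarrow> card (unpaired n A) \<le> 1"
  proof (atomize (full), cases "M = {}")
    case True
    then show "(dagger n A = A \<longleftrightarrow> unpaired n A = {}) \<and>
        (star_dagger n A = A \<longleftrightarrow> card (unpaired n A) \<le> 1)"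
      using star M by (simp add: dagger_def star_dagger_def)
  next
    case False
    define k where "k = (LEAST k. k \<in> {2..n} \<and> mixed C k)"
    have "k \<in> {2..n} \<and> mixed C k"
      unfolding k_def by (rule LeastI_ex) (use False in \<open>auto simp: M_def\<close>)
    then have k: "k \<in> {2..n}" "mixed C k" "k \<in> M" by (auto simp: M_def)
    have dagger: "dagger n A = mat_of_conf n (swap_conf k C)"
      using False star unfolding dagger_def conf k_def Let_def by simp
    note swap = swap_conf_sixV[OF C k(1)]
    have moved: "dagger n A \<noteq> A"
      unfolding dagger eq_A[OF swap] swap_conf_eq_iff[OF o k(1)] using k by simp
    have "star_dagger n A = mat_of_conf n (star_conf n (swap_conf k C))"
      unfolding star_dagger_def o_apply dagger star_def conf_of_mat_mat_of_conf[OF swap] ..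
    then have "star_dagger n A = A \<longleftrightarrow> (\<forall>k' \<in> {2..n} - {k}. \<not> mixed C k')"
      using eq_A[OF star_conf_sixV[OF swap]] star_conf_swap_conf_eq_iff[OF o k(1)] by simp
    also have "\<dots> \<longleftrightarrow> M = {k}"
      unfolding M_def using k by blast
    also have "\<dots> \<longleftrightarrow> card M \<le> 1"
    proof -
      have "finite M" by (simp add: M_def)
      then show ?thesis using k(3) by (auto simp: card_le_Suc0_iff_eq)
    qed
    finally have "star_dagger n A = A \<longleftrightarrow> card (unpaired n A) \<le> 1"
      unfolding card_M .
    moreover have "unpaired n A \<noteq> {}" using False M by simp
    ultimately show "(dagger n A = A \<longleftrightarrow> unpaired n A = {}) \<and>
        (star_dagger n A = A \<longleftrightarrow> card (unpaired n A) \<le> 1)"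
      using moved by blast
  qed
qed

section \<open>The counts\<close>

lemma OSASM_even: "even n \<Longrightarrow> OSASM n = {A \<in> DSASM n. card (diag_supp n A) = 0}"
  unfolding OSASM_def by (auto simp: diag_supp_def)

lemma OSASM_odd: "odd n \<Longrightarrow> OSASM n = {A \<in> DSASM n. card (diag_supp n A) = 1}"
  unfolding OSASM_def by (simp add: diag_supp_def)

lemma
  assumes "even N" "N \<ge> 1"
  shows DSASM_star_even: "DSASM_inv star N = {}"
    and DSASM_dagger_even: "DSASM_inv dagger N = {}"
    and DSASM_star_dagger_even: "DSASM_inv star_dagger N = {A \<in> DSASM N. card (unpaired N A) = 1}"
proof -
  have odd: "odd (card (unpaired N A))" if "A \<in> DSASM N" for A
    using even_card_unpaired[OF that assms(2)] assms(1) by simp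
  then have nonempty: "unpaired N A \<noteq> {}" if "A \<in> DSASM N" for A
    using that by fastforce
  then show "DSASM_inv star N = {}" "DSASM_inv dagger N = {}"
    unfolding DSASM_inv_def by (auto simp: star_fixed_iff dagger_fixed_iff)
  have "card (unpaired N A) \<le> 1 \<longleftrightarrow> card (unpaired N A) = 1" if "A \<in> DSASM N" for A
    using nonempty[OF that] by (simp add: le_Suc_eq)
  then show "DSASM_inv star_dagger N = {A \<in> DSASM N. card (unpaired N A) = 1}"
    unfolding DSASM_inv_def using star_dagger_fixed_iff by blast
qed

lemma DSASM_inv_odd:
  assumes "odd N" "\<nu> \<in> {star, dagger, star_dagger}"
  shows "DSASM_inv \<nu> N = {A \<in> DSASM N. card (unpaired N A) = 0}"
proof -
  have "N \<ge> 1" using assms(1) by (cases N) auto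
  then have "even (card (unpaired N A))" if "A \<in> DSASM N" for A
    using even_card_unpaired[OF that] assms(1) by simp
  moreover have "m \<le> 1 \<longleftrightarrow> m = 0" if "even m" for m :: nat
    using that by presburger
  ultimately have "card (unpaired N A) \<le> 1 \<longleftrightarrow> card (unpaired N A) = 0" if "A \<in> DSASM N" for A
    using that by blast
  then have "\<nu> N A = A \<longleftrightarrow> card (unpaired N A) = 0" if "A \<in> DSASM N" for A
    using assms(2) that by (auto simp: star_fixed_iff dagger_fixed_iff star_dagger_fixed_iff)
  then show ?thesis
    unfolding DSASM_inv_def by blast
qed

lemma OSASM_inv_eq: "OSASM_inv \<nu> N = OSASM N \<inter> DSASM_inv \<nu> N"
  unfolding OSASM_inv_def DSASM_inv_def OSASM_def by blast

text \<open>
  The diagonal support has even size for even N and odd size for odd N, the unpaired set has the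
  opposite parity. So the conditions on the two sizes separately say the same as the condition that
  there is one element altogether.
\<close>

lemma OSASM_inv_one_turn:
  assumes "N \<ge> 1" "\<nu> = star_dagger \<or> odd N \<and> \<nu> \<in> {star, dagger}"
  shows "OSASM_inv \<nu> N = {A \<in> DSASM N. card (diag_supp N A) + card (unpaired N A) = 1}"
proof (cases "even N")
  case True
  have "even (card (diag_supp N A))" if "A \<in> DSASM N" for A
    using even_card_diag_supp[OF that] True by simp
  then have "card (diag_supp N A) \<noteq> 1" if "A \<in> DSASM N" for A
    using that by fastforce
  then show ?thesis
    using True assms unfolding OSASM_inv_eq OSASM_even[OF True]
    by (auto simp: DSASM_star_dagger_even add_is_1)
next
  case False
  have "odd (card (diag_supp N A))" if "A \<in> DSASM N" for A
    using even_card_diag_supp[OF that] False by simp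
  then have "card (diag_supp N A) \<noteq> 0" if "A \<in> DSASM N" for A
    using that by (metis even_zero)
  then show ?thesis
    using False assms(2) unfolding OSASM_inv_eq OSASM_odd[OF False]
    by (auto simp: DSASM_inv_odd add_is_1)
qed

theorem proposition9p2:
  fixes n :: nat
  assumes "n \<ge> 1"
  shows
    "(card (DSASM_inv star (2 * n)) = 0 \<and>
      card (DSASM_inv dagger (2 * n)) = 0 \<and>
      card (OSASM_inv star (2 * n)) = 0 \<and>
      card (OSASM_inv dagger (2 * n)) = 0) \<and>
     (card (DSASM_inv star (2 * n + 1)) = card (OSASM (2 * n)) \<and>
      card (DSASM_inv dagger (2 * n + 1)) = card (OSASM (2 * n)) \<and>
      card (DSASM_inv star_dagger (2 * n + 1)) = card (OSASM (2 * n))) \<and>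
     card (DSASM_inv star_dagger (2 * n)) = 2 * card (OSASM (2 * n - 1)) \<and>
     (card (OSASM_inv star_dagger (2 * n)) = card (ASM n) \<and>
      card (OSASM_inv star (2 * n + 1)) = card (ASM n) \<and>
      card (OSASM_inv dagger (2 * n + 1)) = card (ASM n) \<and>
      card (OSASM_inv star_dagger (2 * n + 1)) = card (ASM n))"
proof -
  have even: "even (2 * n)" "2 * n \<ge> 1" and odd: "odd (2 * n + 1)" "odd (2 * n - 1)"
    using assms by auto
  have "DSASM_inv star (2 * n) = {}" "DSASM_inv dagger (2 * n) = {}"
    using even by (rule DSASM_star_even DSASM_dagger_even)+
  then have none: "card (DSASM_inv star (2 * n)) = 0 \<and> card (DSASM_inv dagger (2 * n)) = 0 \<and>
      card (OSASM_inv star (2 * n)) = 0 \<and> card (OSASM_inv dagger (2 * n)) = 0"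
    by (simp add: OSASM_inv_eq)
  have paired: "card (DSASM_inv \<nu> (2 * n + 1)) = card (OSASM (2 * n))"
    if "\<nu> \<in> {star, dagger, star_dagger}" for \<nu>
    unfolding DSASM_inv_odd[OF odd(1) that] OSASM_even[OF even(1)]
    using card_unpaired_eq[of "2 * n" 0] by simp
  have "Suc (2 * n - 1) = 2 * n" using assms by simp
  then have one_unpaired: "card (DSASM_inv star_dagger (2 * n)) = 2 * card (OSASM (2 * n - 1))"
    unfolding DSASM_star_dagger_even[OF even] OSASM_odd[OF odd(2)]
    using card_unpaired_eq[of "2 * n - 1" 1] by simp
  have one_turn: "card (OSASM_inv \<nu> N) = card (ASM (N div 2))"
    if "N \<ge> 1" "\<nu> = star_dagger \<or> odd N \<and> \<nu> \<in> {star, dagger}" for \<nu> N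
    unfolding OSASM_inv_one_turn[OF that] by (rule card_one_turn[OF that(1)])
  show ?thesis
    using none paired one_unpaired one_turn[of "2 * n"] one_turn[of "2 * n + 1"] even odd by simp
qed

end
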